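(* There is an absolute constant $c_{\mathrm{abs}}>0$ such that for every $d$, every commutator Lipschitz semi-norm $|||\cdot|||_L$ on $\mathbb M_d$ and every unital, strictly positive, completely positive trace-preserving map $\Phi:\mathbb M_d\to\mathbb M_d$, $$\mathrm{LogLip}_L(\Phi,\mathbf 1/d)\le c_{\mathrm{abs}}\,\mathrm{Lip}_L(\Phi)\,\frac{\log^2d}{\lambda_{\min}(\Phi)},$$ where $\lambda_{\min}(\Phi)$ is the minimum, over all density matrices $\rho$, of the smallest eigenvalue of $\Phi(\rho)$.
   Context: Here $d\ge2$. Strictly positive means that $\Phi$ maps every density matrix to a full-rank one. A commutator Lipschitz semi-norm is $|||x|||_L=\sup_{s\in\mathcal S}\|[s,x]\|_{op}$ for a finite set $\mathcal S\subseteq\mathbb M_d$ whose commutant $\mathcal S'$ is a von Neumann algebra. $\mathrm{Lip}_L(\Phi)=\sup\{|||\Phi(x)|||_L: x=x^*\in\mathbb M_d,\ |||x|||_L\le1\}$. Since $|||\mathbf 1|||_L=0$, $$\mathrm{LogLip}_L(\Phi,\mathbf 1/d)=\sup_{\rho}\frac{|||\log\Phi(\rho)-\log(\mathbf 1/d)|||_L}{|||\log\rho-\log(\mathbf 1/d)|||_L}=\sup_\rho\frac{|||\log\Phi(\rho)|||_L}{|||\log\rho|||_L},$$ the supremum being over full-rank density matrices $\rho$ with quotients $0/0$ disregarded and $c/0=\infty$ for $c>0$. *)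

theory Defs
  imports
    "HOL-Library.Extended_Nonnegative_Real"
    "Jordan_Normal_Form.Schur_Decomposition"
    "Jordan_Normal_Form.DL_Rank"
begin

text \<open>
  The dimension \<open>d\<close> varies inside the statement, so \<open>M\<^sub>d\<close> is \<open>carrier_mat d d\<close> over the
  complex numbers. A map on \<open>M\<^sub>d\<close> is a HOL function on \<open>complex mat\<close>; only its values on
  \<open>carrier_mat d d\<close> matter.
\<close>

section \<open>Matrices\<close>

definition hermitian_mat :: "nat \<Rightarrow> complex mat \<Rightarrow> bool" where
  "hermitian_mat d A \<longleftrightarrow> A \<in> carrier_mat d d \<and> mat_adjoint A = A"

definition unitary_mat :: "nat \<Rightarrow> complex mat \<Rightarrow> bool" where
  "unitary_mat d U \<longleftrightarrow>
     U \<in> carrier_mat d d \<and> mat_adjoint U * U = 1\<^sub>m d \<and> U * mat_adjoint U = 1\<^sub>m d"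

text \<open>In the order on \<open>complex\<close>, \<open>0 \<le> z\<close> means that \<open>z\<close> is real and nonnegative.\<close>

definition psd_mat :: "nat \<Rightarrow> complex mat \<Rightarrow> bool" where
  "psd_mat d A \<longleftrightarrow> hermitian_mat d A \<and> (\<forall>v \<in> carrier_vec d. 0 \<le> (A *\<^sub>v v) \<bullet>c v)"

definition tr :: "complex mat \<Rightarrow> complex" where
  "tr A = (\<Sum>i<dim_row A. A $$ (i, i))"

definition density_mat :: "nat \<Rightarrow> complex mat \<Rightarrow> bool" where
  "density_mat d \<rho> \<longleftrightarrow> psd_mat d \<rho> \<and> tr \<rho> = 1"

definition full_rank :: "nat \<Rightarrow> complex mat \<Rightarrow> bool" where
  "full_rank d A \<longleftrightarrow> vec_space.rank d A = d"

definition l2_norm :: "complex vec \<Rightarrow> real" where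
  "l2_norm v = sqrt (Re (v \<bullet>c v))"

definition op_norm :: "nat \<Rightarrow> complex mat \<Rightarrow> real" where
  "op_norm d A = (SUP v \<in> {v \<in> carrier_vec d. l2_norm v \<le> 1}. l2_norm (A *\<^sub>v v))"

text \<open>Used for Hermitian matrices, all of whose eigenvalues are real.\<close>

definition min_eigenvalue :: "complex mat \<Rightarrow> real" where
  "min_eigenvalue A = Min {x :: real. eigenvalue A (complex_of_real x)}"

text \<open>
  Logarithm of a positive definite matrix by functional calculus: diagonalise unitarily and
  apply \<open>ln\<close> to the eigenvalues. The result does not depend on the diagonalisation
  (\<open>log_via_diag_unique\<close> below).
\<close>

definition log_via_diag :: "nat \<Rightarrow> complex mat \<Rightarrow> complex mat \<Rightarrow> bool" where
  "log_via_diag d A L \<longleftrightarrow>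
     (\<exists>U (\<mu> :: nat \<Rightarrow> real). unitary_mat d U \<and> (\<forall>i<d. 0 < \<mu> i) \<and>
        A = U * mat_diag d (\<lambda>i. complex_of_real (\<mu> i)) * mat_adjoint U \<and>
        L = U * mat_diag d (\<lambda>i. complex_of_real (ln (\<mu> i))) * mat_adjoint U)"

definition mat_log :: "nat \<Rightarrow> complex mat \<Rightarrow> complex mat" where
  "mat_log d A = (THE L. log_via_diag d A L)"

lemma mat_adjoint_carrier:
  "U \<in> carrier_mat d d \<Longrightarrow> mat_adjoint U \<in> carrier_mat d d"
  unfolding mat_adjoint_def by (auto simp: mat_of_rows_def)

lemma log_via_diag_unique:
  assumes "log_via_diag d A L" and "log_via_diag d A L'"
  shows "L = L'"
proof -
  let ?D = "\<lambda>f :: nat \<Rightarrow> real. mat_diag d (\<lambda>i. complex_of_real (f i))"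
  obtain U \<mu> where U: "unitary_mat d U" and \<mu>: "\<forall>i<d. 0 < \<mu> i"
    and A: "A = U * ?D \<mu> * mat_adjoint U" and L: "L = U * ?D (\<lambda>i. ln (\<mu> i)) * mat_adjoint U"
    using assms(1) unfolding log_via_diag_def by blast
  obtain V \<nu> where V: "unitary_mat d V" and \<nu>: "\<forall>i<d. 0 < \<nu> i"
    and A': "A = V * ?D \<nu> * mat_adjoint V" and L': "L' = V * ?D (\<lambda>i. ln (\<nu> i)) * mat_adjoint V"
    using assms(2) unfolding log_via_diag_def by blast
  define W where "W = mat_adjoint V * U"
  note as = assoc_mult_mat[where n\<^sub>1=d and n\<^sub>2=d and n\<^sub>3=d and n\<^sub>4=d]
  note mc = mult_carrier_mat[where nr=d and n=d and nc=d] right_mult_one_mat[where nr=d and nc=d]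
    left_mult_one_mat[where nr=d and nc=d]
  note c = U[unfolded unitary_mat_def] V[unfolded unitary_mat_def]
  have Uc: "U \<in> carrier_mat d d" and Vc: "V \<in> carrier_mat d d"
    and Ua: "mat_adjoint U \<in> carrier_mat d d" and Va: "mat_adjoint V \<in> carrier_mat d d"
    using c by (auto intro: mat_adjoint_carrier)
  have W: "W \<in> carrier_mat d d" unfolding W_def using Va Uc by simp
  have Dc: "?D f \<in> carrier_mat d d" for f by simp
  have left: "mat_adjoint V * (U * ?D f * mat_adjoint U) * U = W * ?D f" for f
  proof -
    have "mat_adjoint V * (U * ?D f * mat_adjoint U) * U
        = mat_adjoint V * (U * ?D f * (mat_adjoint U * U))"
      using Uc Va Ua Dc[of f] by (simp add: as mc)
    also have "\<dots> = W * ?D f"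
      using c Uc Va Dc[of f] by (simp add: W_def as mc)
    finally show ?thesis .
  qed
  have right: "mat_adjoint V * (V * ?D f * mat_adjoint V) * U = ?D f * W" for f
  proof -
    have "mat_adjoint V * (V * ?D f * mat_adjoint V) * U
        = (mat_adjoint V * V) * ?D f * (mat_adjoint V * U)"
      using Uc Va Vc Dc[of f] by (simp add: as mc)
    also have "\<dots> = ?D f * W" using c Dc[of f] by (simp add: W_def mc)
    finally show ?thesis .
  qed
  have "W * ?D \<mu> = ?D \<nu> * W" using left[of \<mu>] right[of \<nu>] A A' by simp
  then have eq: "W $$ (i, j) * \<mu> j = \<nu> i * W $$ (i, j)" if "i < d" "j < d" for i j
    using that unfolding mat_diag_mult_left[OF W] mat_diag_mult_right[OF W]
    by (metis (no_types, lifting) case_prod_conv index_mat(1))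
  have "W $$ (i, j) * ln (\<mu> j) = ln (\<nu> i) * W $$ (i, j)" if "i < d" "j < d" for i j
    using eq[OF that] by (cases "W $$ (i, j) = 0") auto
  then have WW: "W * ?D (\<lambda>i. ln (\<mu> i)) = ?D (\<lambda>i. ln (\<nu> i)) * W"
    unfolding mat_diag_mult_left[OF W] mat_diag_mult_right[OF W] by (intro eq_matI) auto
  then have eqL: "mat_adjoint V * L * U = mat_adjoint V * L' * U"
    using left right L L' by metis
  have recover: "V * (mat_adjoint V * X * U) * mat_adjoint U = X"
    if X: "X \<in> carrier_mat d d" for X
  proof -
    have "V * (mat_adjoint V * X * U) * mat_adjoint U
        = (V * mat_adjoint V) * X * (U * mat_adjoint U)"
      using Uc Va Vc Ua X by (simp add: as mc)
    then show ?thesis using c X by (simp add: mc)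
  qed
  have "L \<in> carrier_mat d d" "L' \<in> carrier_mat d d"
    using L L' Uc Ua Vc Va by (auto intro!: mult_carrier_mat)
  then show ?thesis using recover eqL by metis
qed

section \<open>Quantum channels\<close>

definition linear_map_mat :: "nat \<Rightarrow> (complex mat \<Rightarrow> complex mat) \<Rightarrow> bool" where
  "linear_map_mat d \<Phi> \<longleftrightarrow>
     (\<forall>A \<in> carrier_mat d d. \<Phi> A \<in> carrier_mat d d) \<and>
     (\<forall>A \<in> carrier_mat d d. \<forall>B \<in> carrier_mat d d. \<Phi> (A + B) = \<Phi> A + \<Phi> B) \<and>
     (\<forall>c. \<forall>A \<in> carrier_mat d d. \<Phi> (c \<cdot>\<^sub>m A) = c \<cdot>\<^sub>m \<Phi> A)"

text \<open>
  \<open>amplify n d \<Phi>\<close> is \<open>id \<otimes> \<Phi>\<close> on \<open>M\<^sub>n \<otimes> M\<^sub>d\<close>: an \<open>nd \<times> nd\<close> matrix is read as an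
  \<open>n \<times> n\<close> array of \<open>d \<times> d\<close> blocks and \<open>\<Phi>\<close> is applied to each block.
\<close>

definition block :: "nat \<Rightarrow> complex mat \<Rightarrow> nat \<Rightarrow> nat \<Rightarrow> complex mat" where
  "block d X a b = mat d d (\<lambda>(i, j). X $$ (a * d + i, b * d + j))"

definition amplify ::
    "nat \<Rightarrow> nat \<Rightarrow> (complex mat \<Rightarrow> complex mat) \<Rightarrow> complex mat \<Rightarrow> complex mat" where
  "amplify n d \<Phi> X =
     mat (n * d) (n * d) (\<lambda>(i, j). \<Phi> (block d X (i div d) (j div d)) $$ (i mod d, j mod d))"

definition completely_positive :: "nat \<Rightarrow> (complex mat \<Rightarrow> complex mat) \<Rightarrow> bool" where
  "completely_positive d \<Phi> \<longleftrightarrow>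
     linear_map_mat d \<Phi> \<and> (\<forall>n X. psd_mat (n * d) X \<longrightarrow> psd_mat (n * d) (amplify n d \<Phi> X))"

definition trace_preserving :: "nat \<Rightarrow> (complex mat \<Rightarrow> complex mat) \<Rightarrow> bool" where
  "trace_preserving d \<Phi> \<longleftrightarrow> (\<forall>A \<in> carrier_mat d d. tr (\<Phi> A) = tr A)"

definition unital_map :: "nat \<Rightarrow> (complex mat \<Rightarrow> complex mat) \<Rightarrow> bool" where
  "unital_map d \<Phi> \<longleftrightarrow> \<Phi> (1\<^sub>m d) = 1\<^sub>m d"

definition strictly_positive :: "nat \<Rightarrow> (complex mat \<Rightarrow> complex mat) \<Rightarrow> bool" where
  "strictly_positive d \<Phi> \<longleftrightarrow> (\<forall>\<rho>. density_mat d \<rho> \<longrightarrow> density_mat d (\<Phi> \<rho>) \<and> full_rank d (\<Phi> \<rho>))"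

text \<open>The infimum is attained, since the density matrices form a compact set.\<close>

definition lambda_min :: "nat \<Rightarrow> (complex mat \<Rightarrow> complex mat) \<Rightarrow> real" where
  "lambda_min d \<Phi> = (INF \<rho> \<in> {\<rho>. density_mat d \<rho>}. min_eigenvalue (\<Phi> \<rho>))"

section \<open>Commutator Lipschitz seminorms\<close>

definition commutant :: "nat \<Rightarrow> complex mat set \<Rightarrow> complex mat set" where
  "commutant d S = {x \<in> carrier_mat d d. \<forall>s \<in> S. s * x = x * s}"

text \<open>
  A unital *-subalgebra of \<open>M\<^sub>d\<close>, closed in the weak operator topology. In finite dimension
  this is the topology of entrywise convergence, and closedness is automatic.
\<close>

definition von_neumann_algebra :: "nat \<Rightarrow> complex mat set \<Rightarrow> bool" where
  "von_neumann_algebra d M \<longleftrightarrow>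
     M \<subseteq> carrier_mat d d \<and> 1\<^sub>m d \<in> M \<and>
     (\<forall>x \<in> M. \<forall>y \<in> M. x + y \<in> M \<and> x * y \<in> M) \<and>
     (\<forall>c. \<forall>x \<in> M. c \<cdot>\<^sub>m x \<in> M) \<and>
     (\<forall>x \<in> M. mat_adjoint x \<in> M) \<and>
     (\<forall>X. \<forall>y \<in> carrier_mat d d.
        (\<forall>k :: nat. X k \<in> M) \<and> (\<forall>i<d. \<forall>j<d. (\<lambda>k. X k $$ (i, j)) \<longlonglongrightarrow> y $$ (i, j)) \<longrightarrow> y \<in> M)"

text \<open>
  Seminorms take values in \<open>ennreal\<close> because the Lipschitz constants built from them can be
  infinite; the seminorms themselves are finite on \<open>M\<^sub>d\<close>. The set \<open>S\<close> may be empty, giving the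
  zero seminorm.
\<close>

definition commutator_lipschitz_seminorm :: "nat \<Rightarrow> (complex mat \<Rightarrow> ennreal) \<Rightarrow> bool" where
  "commutator_lipschitz_seminorm d L \<longleftrightarrow>
     (\<exists>S. finite S \<and> S \<subseteq> carrier_mat d d \<and> von_neumann_algebra d (commutant d S) \<and>
        (\<forall>x \<in> carrier_mat d d. L x = (SUP s \<in> S. ennreal (op_norm d (s * x - x * s)))))"

definition Lip ::
    "nat \<Rightarrow> (complex mat \<Rightarrow> ennreal) \<Rightarrow> (complex mat \<Rightarrow> complex mat) \<Rightarrow> ennreal" where
  "Lip d L \<Phi> = (SUP x \<in> {x. hermitian_mat d x \<and> L x \<le> 1}. L (\<Phi> x))"

text \<open>
  \<open>\<sigma>\<close> is a full-rank fixed point of \<open>\<Phi>\<close>. Division in \<open>ennreal\<close> satisfies \<open>c / 0 = \<infinity>\<close> for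
  \<open>c > 0\<close>; the quotients \<open>0 / 0\<close> are left out of the supremum.
\<close>

definition LogLip ::
    "nat \<Rightarrow> (complex mat \<Rightarrow> ennreal) \<Rightarrow> (complex mat \<Rightarrow> complex mat) \<Rightarrow> complex mat \<Rightarrow> ennreal" where
  "LogLip d L \<Phi> \<sigma> =
     (let num = (\<lambda>\<rho>. L (mat_log d (\<Phi> \<rho>) - mat_log d \<sigma>));
          den = (\<lambda>\<rho>. L (mat_log d \<rho> - mat_log d \<sigma>))
      in SUP \<rho> \<in> {\<rho>. density_mat d \<rho> \<and> full_rank d \<rho> \<and> \<not> (num \<rho> = 0 \<and> den \<rho> = 0)}.
           num \<rho> / den \<rho>)"

definition maximally_mixed :: "nat \<Rightarrow> complex mat" where
  "maximally_mixed d = (1 / of_nat d) \<cdot>\<^sub>m 1\<^sub>m d"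

end

theory Submission
  imports Defs "HOL-Analysis.L2_Norm"
begin

text \<open>
  The bound holds even without the factor \<open>log\<^sup>2 d\<close>, which is at least \<open>log\<^sup>2 2\<close>.
  If \<open>x\<close> is a contraction then \<open>\<parallel>[s, x\<^sup>k]\<parallel> \<le> k \<parallel>[s, x]\<parallel>\<close>. Applied to
  \<open>\<rho> = lim (1 + (log \<rho>)/n)\<^sup>n\<close> this gives \<open>\<parallel>[s, \<rho>]\<parallel> \<le> \<parallel>[s, log \<rho>]\<parallel>\<close>. Conversely, if \<open>l\<close> is a lower
  bound for the spectrum of \<open>\<sigma> = \<Phi>(\<rho>)\<close>, the power series of the logarithm around the identity
  gives \<open>\<parallel>[s, log \<sigma>]\<parallel> \<le> \<parallel>[s, \<sigma>]\<parallel> / l\<close>. Between the two, \<open>\<Phi>\<close> costs its Lipschitz constant.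
\<close>

subsection \<open>The operator norm\<close>

text \<open>The trace normalisation drives both comparisons: the eigenvalues of a full-rank density
  matrix lie in (0, 1], so log \<rho> \<le> 0 makes 1 + (log \<rho>)/n a contraction for large n,
  and 1 - \<sigma> has norm at most 1 - l < 1. Diagonalising turns functions of a matrix into scalar
  functions on the spectrum, so both approximations converge entrywise as soon as the scalar ones
  do, and operator bounds survive such limits. The reference point 1/d is invisible to the seminorm,
  its logarithm being a multiple of the identity. The remaining difficulty lies in degenerate
  values. \<open>lambda_min d \<Phi>\<close> is an infimum, and its positivity would call for
  compactness of the set of density matrices. The estimate avoids this: where the infimum is not
  positive, the right-hand side is infinite unless the Lipschitz constant is 0, and then the
  smallest eigenvalue of the individual \<Phi>(\<rho>) already shows that the numerator
  vanishes.\<close>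

lemma l2_norm_eq_L2_set: "l2_norm v = L2_set (\<lambda>i. cmod (v $ i)) {..<dim_vec v}"
proof -
  have "Re (v \<bullet>c v) = (\<Sum>i<dim_vec v. (cmod (v $ i))\<^sup>2)"
    unfolding scalar_prod_def
    by (auto simp: atLeast0LessThan complex_mult_cnj cmod_power2 intro!: sum.cong)
  then show ?thesis by (simp add: l2_norm_def L2_set_def)
qed

lemma l2_norm_nonneg: "0 \<le> l2_norm v"
  by (simp add: l2_norm_eq_L2_set L2_set_nonneg)

lemma l2_norm_eq_0: "v \<in> carrier_vec d \<Longrightarrow> l2_norm v = 0 \<longleftrightarrow> v = 0\<^sub>v d"
  by (auto simp: l2_norm_eq_L2_set L2_set_eq_0_iff)

lemma l2_norm_zero [simp]: "l2_norm (0\<^sub>v d) = 0"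
  by (simp add: l2_norm_eq_0[of _ d])

lemma zero_mult_mat_vec: "v \<in> carrier_vec d \<Longrightarrow> 0\<^sub>m n d *\<^sub>v v = 0\<^sub>v n"
  by (intro eq_vecI) auto

lemma l2_norm_smult: "l2_norm (c \<cdot>\<^sub>v v) = cmod c * l2_norm v"
  unfolding l2_norm_eq_L2_set
  by (subst L2_set_right_distrib) (auto simp: norm_mult intro!: L2_set_cong)

lemma l2_norm_triangle:
  assumes "v \<in> carrier_vec d" "w \<in> carrier_vec d"
  shows "l2_norm (v + w) \<le> l2_norm v + l2_norm w"
proof -
  have "l2_norm (v + w) \<le> L2_set (\<lambda>i. cmod (v $ i) + cmod (w $ i)) {..<d}"
    using assms by (auto simp: l2_norm_eq_L2_set intro!: L2_set_mono norm_triangle_ineq)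
  also have "\<dots> \<le> l2_norm v + l2_norm w"
    using assms L2_set_triangle_ineq by (auto simp: l2_norm_eq_L2_set)
  finally show ?thesis .
qed

text \<open>Upper bounds are handled as a predicate because they combine under sums, products and
  limits directly, without reopening the supremum in \<open>op_norm\<close> each time.\<close>

definition op_bound :: "nat \<Rightarrow> complex mat \<Rightarrow> real \<Rightarrow> bool" where
  "op_bound d A K \<longleftrightarrow> (\<forall>v \<in> carrier_vec d. l2_norm (A *\<^sub>v v) \<le> K * l2_norm v)"

lemma op_bound_mono: "op_bound d A K \<Longrightarrow> K \<le> K' \<Longrightarrow> op_bound d A K'"
  unfolding op_bound_def by (meson l2_norm_nonneg mult_right_mono order_trans)

text \<open>A crude entrywise bound is enough: it only serves to make the real-valued supremum in
  \<open>op_norm\<close> range over a bounded set.\<close>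

lemma op_bound_exists:
  assumes A: "A \<in> carrier_mat d d"
  shows "\<exists>K. op_bound d A K"
proof
  let ?K = "\<Sum>i<d. \<Sum>j<d. cmod (A $$ (i, j))"
  show "op_bound d A ?K"
    unfolding op_bound_def
  proof
    fix v :: "complex vec" assume v: "v \<in> carrier_vec d"
    have "l2_norm (A *\<^sub>v v) \<le> (\<Sum>i<d. cmod ((A *\<^sub>v v) $ i))"
      using A L2_set_le_sum[of "{..<d}" "\<lambda>i. cmod ((A *\<^sub>v v) $ i)"]
      by (simp add: l2_norm_eq_L2_set)
    also have "\<dots> \<le> (\<Sum>i<d. \<Sum>j<d. cmod (A $$ (i, j)) * l2_norm v)"
    proof (rule sum_mono)
      fix i assume i: "i \<in> {..<d}"
      have "cmod ((A *\<^sub>v v) $ i) = cmod (\<Sum>j<d. A $$ (i, j) * v $ j)"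
        using A v i by (auto simp: scalar_prod_def atLeast0LessThan)
      also have "\<dots> \<le> (\<Sum>j<d. cmod (A $$ (i, j)) * cmod (v $ j))"
        by (metis (no_types, lifting) norm_mult norm_sum sum.cong)
      also have "\<dots> \<le> (\<Sum>j<d. cmod (A $$ (i, j)) * l2_norm v)"
        using v member_le_L2_set[of "{..<d}" _ "\<lambda>i. cmod (v $ i)"]
        by (intro sum_mono mult_left_mono) (auto simp: l2_norm_eq_L2_set)
      finally show "cmod ((A *\<^sub>v v) $ i) \<le> (\<Sum>j<d. cmod (A $$ (i, j)) * l2_norm v)" .
    qed
    also have "\<dots> = ?K * l2_norm v" by (simp add: sum_distrib_right)
    finally show "l2_norm (A *\<^sub>v v) \<le> ?K * l2_norm v" .
  qed
qed

lemma op_norm_bdd_above: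
  assumes "A \<in> carrier_mat d d"
  shows "bdd_above ((\<lambda>v. l2_norm (A *\<^sub>v v)) ` {v \<in> carrier_vec d. l2_norm v \<le> 1})"
proof -
  obtain K where K: "op_bound d A K" using op_bound_exists[OF assms] ..
  show ?thesis
  proof (rule bdd_aboveI2)
    fix w assume "w \<in> {v \<in> carrier_vec d. l2_norm v \<le> 1}"
    then have w: "w \<in> carrier_vec d" "l2_norm w \<le> 1" by auto
    have "l2_norm (A *\<^sub>v w) \<le> K * l2_norm w" using K w by (simp add: op_bound_def)
    also have "\<dots> \<le> \<bar>K\<bar> * 1"
      using w l2_norm_nonneg[of w] by (intro mult_mono) auto
    finally show "l2_norm (A *\<^sub>v w) \<le> \<bar>K\<bar>" by simp
  qed
qed

lemma op_bound_op_norm: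
  assumes A: "A \<in> carrier_mat d d"
  shows "op_bound d A (op_norm d A)"
  unfolding op_bound_def
proof
  fix v :: "complex vec" assume v: "v \<in> carrier_vec d"
  show "l2_norm (A *\<^sub>v v) \<le> op_norm d A * l2_norm v"
  proof (cases "l2_norm v = 0")
    case True
    then have "v = 0\<^sub>v d" using l2_norm_eq_0[OF v] by simp
    then have "A *\<^sub>v v = 0\<^sub>v d" using A by auto
    then show ?thesis using True by simp
  next
    case False
    let ?c = "complex_of_real (1 / l2_norm v)"
    have pos: "0 < l2_norm v" using False l2_norm_nonneg[of v] by simp
    have "l2_norm (A *\<^sub>v (?c \<cdot>\<^sub>v v)) \<le> op_norm d A"
      unfolding op_norm_def using A v pos
      by (intro cSUP_upper[OF _ op_norm_bdd_above]) (simp_all add: l2_norm_smult norm_divide)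
    also have "A *\<^sub>v (?c \<cdot>\<^sub>v v) = ?c \<cdot>\<^sub>v (A *\<^sub>v v)"
      using A v by (rule mult_mat_vec)
    finally show ?thesis
      using pos by (simp add: l2_norm_smult norm_divide field_simps)
  qed
qed

lemma op_norm_le:
  assumes "op_bound d A K" "0 \<le> K"
  shows "op_norm d A \<le> K"
  unfolding op_norm_def
proof (rule cSUP_least)
  show "{v \<in> carrier_vec d. l2_norm v \<le> 1} \<noteq> {}"
    by (metis (mono_tags, lifting) empty_iff l2_norm_zero mem_Collect_eq zero_carrier_vec
        zero_le_one)
  fix v assume "v \<in> {v \<in> carrier_vec d. l2_norm v \<le> 1}"
  then have v: "v \<in> carrier_vec d" "l2_norm v \<le> 1" by auto
  then have "l2_norm (A *\<^sub>v v) \<le> K * l2_norm v" using assms by (simp add: op_bound_def)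
  also have "\<dots> \<le> K * 1" using v assms by (intro mult_left_mono) auto
  finally show "l2_norm (A *\<^sub>v v) \<le> K" by simp
qed

lemma op_norm_nonneg:
  assumes "A \<in> carrier_mat d d"
  shows "0 \<le> op_norm d A"
proof -
  have "l2_norm (A *\<^sub>v 0\<^sub>v d) \<le> op_norm d A"
    unfolding op_norm_def using assms by (intro cSUP_upper[OF _ op_norm_bdd_above]) auto
  then show ?thesis using l2_norm_nonneg order_trans by blast
qed

lemma op_bound_mult:
  assumes "A \<in> carrier_mat d d" "B \<in> carrier_mat d d"
    and "op_bound d A a" "op_bound d B b" "0 \<le> a"
  shows "op_bound d (A * B) (a * b)"
  unfolding op_bound_def
proof
  fix v :: "complex vec" assume v: "v \<in> carrier_vec d"
  have "l2_norm (A * B *\<^sub>v v) = l2_norm (A *\<^sub>v (B *\<^sub>v v))"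
    using assms(1,2) v by (simp add: assoc_mult_mat_vec)
  also have "\<dots> \<le> a * l2_norm (B *\<^sub>v v)"
    using assms v by (auto simp: op_bound_def)
  also have "\<dots> \<le> a * (b * l2_norm v)"
    using assms v by (auto simp: op_bound_def intro!: mult_left_mono)
  finally show "l2_norm (A * B *\<^sub>v v) \<le> a * b * l2_norm v" by (simp add: mult.assoc)
qed

lemma op_bound_add:
  assumes "A \<in> carrier_mat d d" "B \<in> carrier_mat d d"
    and "op_bound d A a" "op_bound d B b"
  shows "op_bound d (A + B) (a + b)"
  unfolding op_bound_def
proof
  fix v :: "complex vec" assume v: "v \<in> carrier_vec d"
  have "l2_norm ((A + B) *\<^sub>v v) = l2_norm (A *\<^sub>v v + B *\<^sub>v v)"
    using assms(1,2) v by (simp add: add_mult_distrib_mat_vec)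
  also have "\<dots> \<le> l2_norm (A *\<^sub>v v) + l2_norm (B *\<^sub>v v)"
    using assms(1,2) v by (intro l2_norm_triangle[of _ d] mult_mat_vec_carrier[of _ d d]) auto
  also have "\<dots> \<le> a * l2_norm v + b * l2_norm v"
    using assms v by (auto simp: op_bound_def intro!: add_mono)
  finally show "l2_norm ((A + B) *\<^sub>v v) \<le> (a + b) * l2_norm v" by (simp add: algebra_simps)
qed

lemma op_bound_smult:
  assumes "A \<in> carrier_mat d d" "op_bound d A a"
  shows "op_bound d (c \<cdot>\<^sub>m A) (cmod c * a)"
  unfolding op_bound_def
proof
  fix v :: "complex vec" assume v: "v \<in> carrier_vec d"
  have "c \<cdot>\<^sub>m A *\<^sub>v v = c \<cdot>\<^sub>v (A *\<^sub>v v)" using assms(1) v by (auto simp: scalar_prod_def sum_distrib_left ac_simps)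
  then show "l2_norm (c \<cdot>\<^sub>m A *\<^sub>v v) \<le> cmod c * a * l2_norm v"
    using assms v by (auto simp: op_bound_def l2_norm_smult mult.assoc intro!: mult_left_mono)
qed

text \<open>Submultiplicativity for \<open>c\<close> gives one inequality, and for
  \<open>1 / c\<close> applied to \<open>c \<cdot>\<^sub>m A\<close> the other.\<close>

lemma op_norm_smult:
  assumes A: "A \<in> carrier_mat d d"
  shows "op_norm d (c \<cdot>\<^sub>m A) = cmod c * op_norm d A"
proof (cases "c = 0")
  case True
  have "op_norm d (c \<cdot>\<^sub>m A) \<le> 0"
    using op_bound_smult[OF A op_bound_op_norm[OF A], of c] True by (intro op_norm_le) auto
  then show ?thesis using op_norm_nonneg[of "c \<cdot>\<^sub>m A" d] A True by simp
next
  case False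
  have le: "op_norm d (c \<cdot>\<^sub>m B) \<le> cmod c * op_norm d B" if "B \<in> carrier_mat d d" for c B
    using that by (intro op_norm_le op_bound_smult op_bound_op_norm mult_nonneg_nonneg op_norm_nonneg) auto
  have "(1 / c) \<cdot>\<^sub>m (c \<cdot>\<^sub>m A) = A" using False by (intro eq_matI) auto
  then have "op_norm d A \<le> cmod (1 / c) * op_norm d (c \<cdot>\<^sub>m A)"
    using le[of "c \<cdot>\<^sub>m A" "1 / c"] A by simp
  then have "cmod c * op_norm d A \<le> op_norm d (c \<cdot>\<^sub>m A)"
    using False by (simp add: norm_divide field_simps)
  then show ?thesis using le[OF A, of c] by simp
qed

text \<open>For a fixed vector, the norm of its image is a continuous function of the finitely many
  entries of the matrix, so entrywise convergence suffices.\<close>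

lemma op_bound_limit:
  assumes X: "\<And>n. X n \<in> carrier_mat d d" and Y: "Y \<in> carrier_mat d d"
    and lim: "\<And>i j. i < d \<Longrightarrow> j < d \<Longrightarrow> (\<lambda>n. X n $$ (i, j)) \<longlonglongrightarrow> Y $$ (i, j)"
    and bound: "eventually (\<lambda>n. op_bound d (X n) K) sequentially"
  shows "op_bound d Y K"
  unfolding op_bound_def
proof
  fix v :: "complex vec" assume v: "v \<in> carrier_vec d"
  have eq: "l2_norm (A *\<^sub>v v) = sqrt (\<Sum>i<d. (cmod (\<Sum>j<d. A $$ (i, j) * v $ j))\<^sup>2)"
    if "A \<in> carrier_mat d d" for A
    using that v by (auto simp: l2_norm_eq_L2_set L2_set_def scalar_prod_def atLeast0LessThan
        intro!: sum.cong)
  have "(\<lambda>n. l2_norm (X n *\<^sub>v v)) \<longlonglongrightarrow> l2_norm (Y *\<^sub>v v)"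
    unfolding eq[OF X] eq[OF Y]
    by (intro tendsto_intros lim) auto
  then show "l2_norm (Y *\<^sub>v v) \<le> K * l2_norm v"
    using bound v by (elim tendsto_upperbound) (auto simp: op_bound_def elim: eventually_mono)
qed

subsection \<open>Commutators\<close>

definition commutator :: "complex mat \<Rightarrow> complex mat \<Rightarrow> complex mat" where
  "commutator s x = s * x - x * s"

lemma commutator_carrier [simp]:
  "s \<in> carrier_mat d d \<Longrightarrow> x \<in> carrier_mat d d \<Longrightarrow> commutator s x \<in> carrier_mat d d"
  unfolding commutator_def by auto

lemma commutator_add:
  assumes "s \<in> carrier_mat d d" "x \<in> carrier_mat d d" "y \<in> carrier_mat d d"
  shows "commutator s (x + y) = commutator s x + commutator s y"
  using assms unfolding commutator_def
  by (intro eq_matI) (auto simp: mult_add_distrib_mat[of _ d d _ d] add_mult_distrib_mat[of _ d d _ _ d])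

lemma commutator_smult:
  assumes "s \<in> carrier_mat d d" "x \<in> carrier_mat d d"
  shows "commutator s (c \<cdot>\<^sub>m x) = c \<cdot>\<^sub>m commutator s x"
  using assms unfolding commutator_def
  by (intro eq_matI) (auto simp: algebra_simps)

lemma commutator_one:
  assumes "s \<in> carrier_mat d d"
  shows "commutator s (1\<^sub>m d) = 0\<^sub>m d d"
  using assms unfolding commutator_def by auto

text \<open>Leibniz rule: commuting with \<open>s\<close> is a derivation. The mixed term
  \<open>x * (s * y)\<close> is inserted and cancels.\<close>

lemma commutator_mult:
  assumes s: "s \<in> carrier_mat d d" and x: "x \<in> carrier_mat d d" and y: "y \<in> carrier_mat d d"
  shows "commutator s (x * y) = commutator s x * y + x * commutator s y"
proof -
  have c: "s * x \<in> carrier_mat d d" "x * s \<in> carrier_mat d d" "s * y \<in> carrier_mat d d"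
    "y * s \<in> carrier_mat d d"  using s x y by auto
  have 1: "commutator s x * y = s * (x * y) - x * (s * y)"
    unfolding commutator_def using s x y c
    by (subst minus_mult_distrib_mat[of _ d d]) auto
  have 2: "x * commutator s y = x * (s * y) - (x * y) * s"
    unfolding commutator_def using s x y c
    by (subst mult_minus_distrib_mat[of _ d d]) auto
  have m: "s * (x * y) \<in> carrier_mat d d" "x * (s * y) \<in> carrier_mat d d" "(x * y) * s \<in> carrier_mat d d"
    using s x y c by auto
  have eq: "P - R = (P - Q) + (Q - R)"
    if "P \<in> carrier_mat d d" "Q \<in> carrier_mat d d" "R \<in> carrier_mat d d" for P Q R :: "complex mat"
    using that by (intro eq_matI) auto
  have "commutator s (x * y) = s * (x * y) - (x * y) * s" by (simp add: commutator_def)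
  also have "\<dots> = commutator s x * y + x * commutator s y"
    unfolding 1 2 by (rule eq[OF m])
  finally show ?thesis .
qed

lemma op_bound_pow:
  assumes "x \<in> carrier_mat d d" "op_bound d x r" "0 \<le> r"
  shows "op_bound d (x ^\<^sub>m k) (r ^ k)"
proof (induction k)
  case 0
  then show ?case using assms by (auto simp: op_bound_def)
next
  case (Suc k)
  then show ?case
    using assms op_bound_mult[of "x ^\<^sub>m k" d x "r ^ k" r] by (simp add: mult.commute)
qed

text \<open>By the Leibniz rule the commutator falls on each of the \<open>k\<close> factors in
  turn, and the other \<open>k - 1\<close> factors are each bounded by \<open>r\<close>.\<close>

lemma op_bound_commutator_pow:
  assumes "s \<in> carrier_mat d d" "x \<in> carrier_mat d d"
    and "op_bound d x r" "0 \<le> r" "op_bound d (commutator s x) c" "0 \<le> c"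
  shows "op_bound d (commutator s (x ^\<^sub>m k)) (real k * r ^ (k - 1) * c)"
proof (induction k)
  case 0
  then show ?case using assms by (auto simp: op_bound_def commutator_one zero_mult_mat_vec)
next
  case (Suc k)
  have "op_bound d (commutator s (x ^\<^sub>m k) * x + x ^\<^sub>m k * commutator s x)
     (real k * r ^ (k - 1) * c * r + r ^ k * c)"
    using assms Suc
    by (intro op_bound_add op_bound_mult op_bound_pow mult_carrier_mat[of _ d d _ d]) auto
  \<comment> \<open>The case split is due to truncated subtraction: for \<open>k = 0\<close> the
    exponent \<open>k - 1\<close> is 0, but the factor \<open>real k\<close> removes that
    term.\<close>
  moreover have "real k * r ^ (k - 1) * c * r + r ^ k * c = real (Suc k) * r ^ (Suc k - 1) * c"
    by (cases k) (auto simp: algebra_simps)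
  ultimately show ?case
    using assms commutator_mult[of s d "x ^\<^sub>m k" x] by simp
qed

subsection \<open>Unitary diagonalisation\<close>

lemma mat_adjoint_dim [simp]:
  "dim_row (mat_adjoint A) = dim_col A" "dim_col (mat_adjoint A) = dim_row A"
  unfolding mat_adjoint_def by auto

lemma mat_adjoint_index [simp]:
  "i < dim_col A \<Longrightarrow> j < dim_row A \<Longrightarrow> mat_adjoint A $$ (i, j) = cnj (A $$ (j, i))"
  unfolding mat_adjoint_def by (auto simp: mat_of_rows_def)

lemma mat_adjoint_mult:
  fixes A B :: "complex mat"
  assumes "A \<in> carrier_mat n m" "B \<in> carrier_mat m k"
  shows "mat_adjoint (A * B) = mat_adjoint B * mat_adjoint A"
  using assms by (intro eq_matI) (auto simp: scalar_prod_def ac_simps)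

lemma mat_adjoint_adjoint [simp]: "mat_adjoint (mat_adjoint (A :: complex mat)) = A"
  by (intro eq_matI) auto

lemma cscalar_prod_adjoint:
  fixes A :: "complex mat" and v w :: "complex vec"
  assumes "A \<in> carrier_mat n m" "v \<in> carrier_vec m" "w \<in> carrier_vec n"
  shows "(A *\<^sub>v v) \<bullet>c w = v \<bullet>c (mat_adjoint A *\<^sub>v w)"
proof -
  have "(A *\<^sub>v v) \<bullet>c w = (\<Sum>i<n. \<Sum>j<m. A $$ (i, j) * v $ j * cnj (w $ i))"
    using assms by (simp add: scalar_prod_def atLeast0LessThan sum_distrib_right)
  also have "\<dots> = (\<Sum>j<m. \<Sum>i<n. A $$ (i, j) * v $ j * cnj (w $ i))"
    by (rule sum.swap)
  also have "\<dots> = v \<bullet>c (mat_adjoint A *\<^sub>v w)"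
    using assms by (simp add: scalar_prod_def atLeast0LessThan sum_distrib_left ac_simps)
  finally show ?thesis .
qed

lemma unitary_matD:
  assumes "unitary_mat d U"
  shows "U \<in> carrier_mat d d" "mat_adjoint U \<in> carrier_mat d d"
    "mat_adjoint U * U = 1\<^sub>m d" "U * mat_adjoint U = 1\<^sub>m d"
  using assms mat_adjoint_carrier unfolding unitary_mat_def by auto

lemma unitary_matI:
  assumes "U \<in> carrier_mat d d" "mat_adjoint U * U = 1\<^sub>m d"
  shows "unitary_mat d U"
  using assms mat_mult_left_right_inverse[of "mat_adjoint U" d U] mat_adjoint_carrier[of U d]
  unfolding unitary_mat_def by auto

lemma unitary_mat_adjoint: "unitary_mat d U \<Longrightarrow> unitary_mat d (mat_adjoint U)"
  using mat_adjoint_carrier unfolding unitary_mat_def by auto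

lemma unitary_mat_mult:
  assumes U: "unitary_mat d U" and V: "unitary_mat d V"
  shows "unitary_mat d (U * V)"
proof (rule unitary_matI)
  note c = unitary_matD[OF U] unitary_matD[OF V]
  show "U * V \<in> carrier_mat d d" using c by auto
  have "mat_adjoint U * (U * V) = V"
    using c assoc_mult_mat[of "mat_adjoint U" d d U d V d] by simp
  then show "mat_adjoint (U * V) * (U * V) = 1\<^sub>m d"
    using c by (simp add: mat_adjoint_mult[of _ d d _ d] assoc_mult_mat[of _ d d _ d _ d])
qed

lemma l2_norm_unitary:
  assumes U: "unitary_mat d U" and v: "v \<in> carrier_vec d"
  shows "l2_norm (U *\<^sub>v v) = l2_norm v"
proof -
  note c = unitary_matD[OF U]
  have "mat_adjoint U *\<^sub>v (U *\<^sub>v v) = v"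
    using c v assoc_mult_mat_vec[of "mat_adjoint U" d d U d v] by simp
  then show ?thesis
    using c v cscalar_prod_adjoint[of U d d v "U *\<^sub>v v"] by (simp add: l2_norm_def)
qed

text \<open>Complete \<open>v\<close> to a basis and apply Gram-Schmidt, which keeps the first
  vector. The result is orthogonal but not normalised, so each column is divided by its norm; this
  is the source of the scalar \<open>c\<close>.\<close>

lemma unitary_mat_first_col:
  fixes v :: "complex vec"
  assumes v: "v \<in> carrier_vec n" and v0: "v \<noteq> 0\<^sub>v n"
  obtains W c where "unitary_mat n W" "col W 0 = c \<cdot>\<^sub>v v"
proof -
  interpret cof_vec_space n "TYPE(complex)" .
  have n: "0 < n" using v v0 by (cases n) auto
  define b where "b = basis_completion v"
  define ws where "ws = gram_schmidt n b"
  note bc = basis_completion[OF v v0, folded b_def]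
  obtain vs where bv: "b = v # vs" using bc(6,7) n by (cases b) auto
  from gram_schmidt_result[OF bc(2) bc(4) bc(5) refl, folded ws_def]
  have ws: "set ws \<subseteq> carrier_vec n" "corthogonal ws" "length ws = n"
    using bc(6) by auto
  have hd: "hd ws = v" using gram_schmidt_hd[OF v, of vs] bv ws_def by simp
  define c where "c i = complex_of_real (1 / l2_norm (ws ! i))" for i
  define W where "W = mat_of_cols n (map (\<lambda>i. c i \<cdot>\<^sub>v ws ! i) [0..<n])"
  have wsi: "ws ! i \<in> carrier_vec n" if "i < n" for i using ws that by auto
  have W: "W \<in> carrier_mat n n" unfolding W_def by (auto simp: mat_of_cols_def)
  have colW: "col W i = c i \<cdot>\<^sub>v ws ! i" if "i < n" for i
    unfolding W_def using that wsi by (subst col_mat_of_cols) auto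
  have sq: "ws ! i \<bullet>c ws ! i = complex_of_real ((l2_norm (ws ! i))\<^sup>2)" if "i < n" for i
  proof -
    have "0 \<le> ws ! i \<bullet>c ws ! i" by (rule conjugate_square_ge_0_vec)
    then have "Im (ws ! i \<bullet>c ws ! i) = 0" "0 \<le> Re (ws ! i \<bullet>c ws ! i)" by (auto simp: less_eq_complex_def)
    then show ?thesis by (simp add: l2_norm_def complex_eq_iff)
  qed
  have nz: "l2_norm (ws ! i) \<noteq> 0" if "i < n" for i
    using sq[OF that] corthogonalD[OF ws(2), of i i] ws(3) that by auto
  have "mat_adjoint W * W = 1\<^sub>m n"
  proof (rule eq_matI)
    fix i j assume ij: "i < dim_row (1\<^sub>m n :: complex mat)" "j < dim_col (1\<^sub>m n :: complex mat)"
    then have i: "i < n" and j: "j < n" by auto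
    \<comment> \<open>The indices swap because \<open>\<bullet>c\<close> conjugates its second
      argument.\<close>
    have "(mat_adjoint W * W) $$ (i, j) = col W j \<bullet>c col W i"
      using W i j by (auto simp: scalar_prod_def ac_simps intro!: sum.cong)
    also have "\<dots> = c j * cnj (c i) * (ws ! j \<bullet>c ws ! i)"
      using wsi[OF i] wsi[OF j]
      by (simp add: colW i j scalar_prod_def sum_distrib_left ac_simps)
    also have "\<dots> = (if i = j then 1 else 0)"
      using corthogonalD[OF ws(2), of j i] ws(3) i j nz[OF i]
      by (auto simp: sq c_def power2_eq_square)
    finally show "(mat_adjoint W * W) $$ (i, j) = 1\<^sub>m n $$ (i, j)" using i j by simp
  qed (use W in auto)
  then have "unitary_mat n W" using W by (rule unitary_matI[rotated])
  moreover have "col W 0 = c 0 \<cdot>\<^sub>v v"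
    using colW[OF n] hd ws(3) n by (simp add: hd_conv_nth[symmetric] flip: length_greater_0_conv)
  ultimately show ?thesis using that by blast
qed

lemma complex_eigenvalue_exists:
  fixes A :: "complex mat"
  assumes A: "A \<in> carrier_mat n n" and n: "0 < n"
  obtains e v where "v \<in> carrier_vec n" "v \<noteq> 0\<^sub>v n" "A *\<^sub>v v = e \<cdot>\<^sub>v v"
proof -
  have "degree (char_poly A) = n" using degree_monic_char_poly[OF A] by simp
  then have "\<not> constant (poly (char_poly A))" using n by (simp add: constant_degree)
  then obtain e where "poly (char_poly A) e = 0" using fundamental_theorem_of_algebra by blast
  then have "eigenvalue A e" using eigenvalue_root_char_poly[OF A] by simp
  then show ?thesis using that A unfolding eigenvalue_def eigenvector_def by auto
qed

text \<open>The argument \<open>f\<close> depends on the position, not on the eigenvalue. With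
  \<open>U\<close> fixed, functional calculus becomes pointwise algebra on \<open>f\<close>, and the
  shape agrees with \<open>log_via_diag\<close>.\<close>

definition unitary_diag :: "nat \<Rightarrow> complex mat \<Rightarrow> (nat \<Rightarrow> real) \<Rightarrow> complex mat" where
  "unitary_diag d U f = U * mat_diag d (\<lambda>i. complex_of_real (f i)) * mat_adjoint U"

lemma hermitian_mat_conj:
  assumes A: "hermitian_mat d A" and V: "V \<in> carrier_mat d d"
  shows "hermitian_mat d (mat_adjoint V * A * V)"
  using assms mat_adjoint_carrier[OF V] unfolding hermitian_mat_def
  by (auto simp: mat_adjoint_mult[of _ d d _ d] assoc_mult_mat[of _ d d _ d _ d])

text \<open>Spectral theorem by deflation. In a unitary basis starting with an eigenvector, the
  first column is a multiple of the first unit vector; being Hermitian forces the same on the first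
  row, and the induction hypothesis diagonalises the remaining block.\<close>

theorem hermitian_unitary_diag:
  assumes "hermitian_mat d A"
  shows "\<exists>U \<mu>. unitary_mat d U \<and> A = unitary_diag d U \<mu>"
  using assms
proof (induction d arbitrary: A)
  case 0
  then show ?case
    by (intro exI[of _ "1\<^sub>m 0"] exI)
      (auto simp: unitary_mat_def unitary_diag_def hermitian_mat_def intro!: eq_matI)
next
  case (Suc m)
  let ?n = "Suc m"
  have A: "A \<in> carrier_mat ?n ?n" using Suc.prems by (simp add: hermitian_mat_def)
  obtain e v where v: "v \<in> carrier_vec ?n" "v \<noteq> 0\<^sub>v ?n" and ev: "A *\<^sub>v v = e \<cdot>\<^sub>v v"
    using complex_eigenvalue_exists[OF A] by blast
  obtain W c where W: "unitary_mat ?n W" and W0: "col W 0 = c \<cdot>\<^sub>v v"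
    using unitary_mat_first_col[OF v] .
  note Wc = unitary_matD[OF W]
  define A' where "A' = mat_adjoint W * A * W"
  have A': "hermitian_mat ?n A'" unfolding A'_def using Suc.prems Wc(1) by (rule hermitian_mat_conj)
  then have A'c: "A' \<in> carrier_mat ?n ?n" by (simp add: hermitian_mat_def)
  have herm: "cnj (A' $$ (j, i)) = A' $$ (i, j)" if "i < ?n" "j < ?n" for i j
    using A' that A'c unfolding hermitian_mat_def by (metis carrier_matD mat_adjoint_index)
  have col0: "col A' 0 = e \<cdot>\<^sub>v unit_vec ?n 0"
  proof -
    have "col A' 0 = mat_adjoint W *\<^sub>v (A *\<^sub>v col W 0)"
      unfolding A'_def assoc_mult_mat[OF Wc(2) A Wc(1)]
      using col_mult2[OF Wc(2) mult_carrier_mat[OF A Wc(1)], of 0] col_mult2[OF A Wc(1), of 0]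
      by simp
    also have "A *\<^sub>v col W 0 = e \<cdot>\<^sub>v col W 0"
      using A v ev by (simp add: W0 mult_mat_vec[of _ ?n ?n] smult_smult_assoc mult.commute)
    also have "mat_adjoint W *\<^sub>v (e \<cdot>\<^sub>v col W 0) = e \<cdot>\<^sub>v (mat_adjoint W *\<^sub>v col W 0)"
      using Wc(1,2) by (intro mult_mat_vec[of _ ?n ?n] carrier_vecI) auto
    also have "mat_adjoint W *\<^sub>v col W 0 = col (mat_adjoint W * W) 0"
      using col_mult2[OF Wc(2) Wc(1), of 0] by simp
    finally show ?thesis using Wc by simp
  qed
  then have A'0: "A' $$ (i, 0) = (if i = 0 then e else 0)" if "i < ?n" for i
    proof -
    have "col A' 0 $ i = (e \<cdot>\<^sub>v unit_vec ?n 0) $ i" using col0 by simp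
    then show ?thesis using that A'c by (cases "i = 0") auto
  qed
  then have A'0': "A' $$ (0, j) = (if j = 0 then e else 0)" if "j < ?n" for j
    using that herm[of 0 j] A'0[of j] herm[of 0 0] by (auto split: if_splits)
  \<comment> \<open>The eigenvalue came from the fundamental theorem of algebra and is only known to
    be complex; it is real as a diagonal entry of a Hermitian matrix.\<close>
  have er: "e = complex_of_real (Re e)"
    using herm[of 0 0] A'0[of 0] by (auto simp: complex_eq_iff)
  define A3 where "A3 = mat m m (\<lambda>(i, j). A' $$ (Suc i, Suc j))"
  have "hermitian_mat m A3"
    unfolding hermitian_mat_def A3_def by (auto simp: herm intro!: eq_matI)
  from Suc.IH[OF this] obtain V \<nu> where V: "unitary_mat m V" and A3: "A3 = unitary_diag m V \<nu>"
    by blast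
  note Vc = unitary_matD[OF V]
  \<comment> \<open>The block sum of the scalar 1 and \<open>V\<close>; accordingly
    \<open>\<mu>\<close> puts the split-off eigenvalue in front of \<open>\<nu>\<close>.\<close>
  define V' where "V' = mat ?n ?n
    (\<lambda>(i, j). case (i, j) of (0, 0) \<Rightarrow> 1 | (Suc i, Suc j) \<Rightarrow> V $$ (i, j) | _ \<Rightarrow> 0)"
  define \<mu> where "\<mu> = (\<lambda>i. case i of 0 \<Rightarrow> Re e | Suc i \<Rightarrow> \<nu> i)"
  have V'c: "V' \<in> carrier_mat ?n ?n" by (simp add: V'_def)
  have V': "unitary_mat ?n V'"
  proof (rule unitary_matI[OF V'c], rule eq_matI)
    fix i j assume "i < dim_row (1\<^sub>m ?n :: complex mat)" "j < dim_col (1\<^sub>m ?n :: complex mat)"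
    then have ij: "i < ?n" "j < ?n" by auto
    have VV: "(\<Sum>k<m. cnj (V $$ (k, i)) * V $$ (k, j)) = (if i = j then 1 else 0)"
      if "i < m" "j < m" for i j
      using arg_cong[OF Vc(3), of "\<lambda>M. M $$ (i, j)"] that Vc(1)
      by (simp add: scalar_prod_def atLeast0LessThan)
    have "(mat_adjoint V' * V') $$ (i, j) = (\<Sum>k<Suc m. cnj (V' $$ (k, i)) * V' $$ (k, j))"
      using V'c ij by (simp add: scalar_prod_def atLeast0LessThan del: sum.lessThan_Suc)
    also have "\<dots> = (if i = j then 1 else 0)"
      using ij VV by (simp add: sum.lessThan_Suc_shift V'_def split: nat.split del: sum.lessThan_Suc)
    finally show "(mat_adjoint V' * V') $$ (i, j) = 1\<^sub>m ?n $$ (i, j)" using ij by simp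
  qed (use V'c in auto)
  have A'eq: "A' = unitary_diag ?n V' \<mu>"
  proof (rule eq_matI)
    fix i j assume "i < dim_row (unitary_diag ?n V' \<mu>)" "j < dim_col (unitary_diag ?n V' \<mu>)"
    then have ij: "i < ?n" "j < ?n" using V'c by (auto simp: unitary_diag_def)
    have A3e: "A' $$ (Suc i, Suc j) = (\<Sum>k<m. V $$ (i, k) * complex_of_real (\<nu> k) * cnj (V $$ (j, k)))"
      if "i < m" "j < m" for i j
      using arg_cong[OF A3, of "\<lambda>M. M $$ (i, j)"] that Vc(1)
      by (simp add: scalar_prod_def atLeast0LessThan unitary_diag_def A3_def mat_diag_mult_right[of _ m m])
    have "unitary_diag ?n V' \<mu> $$ (i, j) =
        (\<Sum>k<Suc m. V' $$ (i, k) * complex_of_real (\<mu> k) * cnj (V' $$ (j, k)))"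
      using V'c ij by (simp add: scalar_prod_def atLeast0LessThan unitary_diag_def
          mat_diag_mult_right[of _ ?n ?n] del: sum.lessThan_Suc)
    also have "\<dots> = A' $$ (i, j)"
      using ij A3e A'0 A'0' er by (simp add: sum.lessThan_Suc_shift V'_def \<mu>_def split: nat.split del: sum.lessThan_Suc)
    finally show "A' $$ (i, j) = unitary_diag ?n V' \<mu> $$ (i, j)" by simp
  qed (use V'c A'c in \<open>auto simp: unitary_diag_def\<close>)
  note V'D = unitary_matD[OF V']
  have "A = (W * mat_adjoint W) * A * (W * mat_adjoint W)"
    using A Wc(4) by simp
  also have "\<dots> = W * A' * mat_adjoint W"
    unfolding A'_def using A Wc(1,2) by (simp add: assoc_mult_mat[of _ ?n ?n _ ?n _ ?n])
  also have "\<dots> = unitary_diag ?n (W * V') \<mu>"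
    unfolding A'eq unitary_diag_def using Wc(1,2) V'D(1,2)
    by (simp add: assoc_mult_mat[of _ ?n ?n _ ?n _ ?n] mat_adjoint_mult[of _ ?n ?n _ ?n]
        mult_carrier_mat[of _ ?n ?n _ ?n])
  finally show ?case using unitary_mat_mult[OF W V'] by blast
qed

section \<open>Functional calculus in a fixed eigenbasis\<close>

lemma unitary_diag_carrier [simp]:
  "unitary_mat d U \<Longrightarrow> unitary_diag d U f \<in> carrier_mat d d"
  unfolding unitary_diag_def
  using unitary_matD[of d U] by (auto intro!: mult_carrier_mat[of _ d d _ d])

lemma unitary_diag_dim [simp]:
  assumes "unitary_mat d U"
  shows "dim_row (unitary_diag d U f) = d" "dim_col (unitary_diag d U f) = d"
  using unitary_diag_carrier[OF assms, of f] by auto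

lemma unitary_diag_index:
  assumes "unitary_mat d U" "i < d" "j < d"
  shows "unitary_diag d U f $$ (i, j) =
    (\<Sum>k<d. U $$ (i, k) * complex_of_real (f k) * cnj (U $$ (j, k)))"
  using assms(2,3) unitary_matD(1)[OF assms(1)]
  by (simp add: scalar_prod_def atLeast0LessThan unitary_diag_def mat_diag_mult_right[of _ d d])

lemma unitary_diag_add:
  "unitary_mat d U \<Longrightarrow>
    unitary_diag d U f + unitary_diag d U g = unitary_diag d U (\<lambda>i. f i + g i)"
  by (intro eq_matI) (auto simp: unitary_diag_index distrib_left distrib_right sum.distrib)

lemma unitary_diag_smult:
  "unitary_mat d U \<Longrightarrow>
    complex_of_real c \<cdot>\<^sub>m unitary_diag d U f = unitary_diag d U (\<lambda>i. c * f i)"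
  by (intro eq_matI) (auto simp: unitary_diag_index sum_distrib_left mult_ac)

lemma unitary_diag_const:
  assumes "unitary_mat d U"
  shows "unitary_diag d U (\<lambda>i. c) = complex_of_real c \<cdot>\<^sub>m 1\<^sub>m d"
proof -
  have "unitary_diag d U (\<lambda>i. 1) = 1\<^sub>m d"
    using unitary_matD[OF assms] by (simp add: unitary_diag_def)
  then show ?thesis using unitary_diag_smult[OF assms, of c "\<lambda>i. 1"] by simp
qed

lemma unitary_diag_mult:
  assumes U: "unitary_mat d U"
  shows "unitary_diag d U f * unitary_diag d U g = unitary_diag d U (\<lambda>i. f i * g i)"
proof -
  note c = unitary_matD[OF U]
  let ?D = "\<lambda>f :: nat \<Rightarrow> real. mat_diag d (\<lambda>i. complex_of_real (f i))"
  have "unitary_diag d U f * unitary_diag d U g = U * ?D f * (mat_adjoint U * U) * (?D g * mat_adjoint U)"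
    unfolding unitary_diag_def using c(1,2)
    by (simp add: assoc_mult_mat[of _ d d _ d _ d] mult_carrier_mat[of _ d d _ d])
  also have "\<dots> = U * (?D f * ?D g) * mat_adjoint U"
    using c by (simp add: assoc_mult_mat[of _ d d _ d _ d] mult_carrier_mat[of _ d d _ d]
        left_mult_one_mat[of _ d d] del: mat_diag_diag)
  finally show ?thesis by (simp add: unitary_diag_def)
qed

lemma unitary_diag_pow:
  assumes U: "unitary_mat d U"
  shows "unitary_diag d U f ^\<^sub>m k = unitary_diag d U (\<lambda>i. f i ^ k)"
proof (induction k)
  case 0
  have "complex_of_real 1 \<cdot>\<^sub>m 1\<^sub>m d = 1\<^sub>m d" by (intro eq_matI) auto
  then show ?case using U unitary_diag_const[OF U, of 1] by simp
qed (simp add: unitary_diag_mult[OF U] mult.commute)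

lemma unitary_diag_cong:
  assumes "unitary_mat d U" "\<And>i. i < d \<Longrightarrow> f i = g i"
  shows "unitary_diag d U f = unitary_diag d U g"
  using assms by (intro eq_matI) (auto simp: unitary_diag_index)

lemma unitary_diag_tendsto:
  assumes U: "unitary_mat d U" and ij: "i < d" "j < d"
    and "\<And>k. k < d \<Longrightarrow> (\<lambda>n. f n k) \<longlonglongrightarrow> g k"
  shows "(\<lambda>n. unitary_diag d U (f n) $$ (i, j)) \<longlonglongrightarrow> unitary_diag d U g $$ (i, j)"
  unfolding unitary_diag_index[OF U ij] using assms(4)
  by (intro tendsto_intros) auto

text \<open>The two unitaries preserve the norm, so only the diagonal factor counts, and it scales
  each coordinate by at most \<open>r\<close>.\<close>

lemma op_bound_unitary_diag:
  assumes U: "unitary_mat d U" and f: "\<And>i. i < d \<Longrightarrow> \<bar>f i\<bar> \<le> r" and r: "0 \<le> r"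
  shows "op_bound d (unitary_diag d U f) r"
  unfolding op_bound_def
proof
  fix v :: "complex vec" assume v: "v \<in> carrier_vec d"
  note c = unitary_matD[OF U]
  let ?D = "mat_diag d (\<lambda>i. complex_of_real (f i))"
  define w where "w = mat_adjoint U *\<^sub>v v"
  have w: "w \<in> carrier_vec d" using mult_mat_vec_carrier[OF c(2) v] by (simp add: w_def)
  have "l2_norm (unitary_diag d U f *\<^sub>v v) = l2_norm (U *\<^sub>v (?D *\<^sub>v w))"
    unfolding unitary_diag_def w_def using c v by (simp add: assoc_mult_mat_vec[of _ d d _ d] mult_carrier_mat[of _ d d _ d])
  also have "\<dots> = l2_norm (?D *\<^sub>v w)"
    by (rule l2_norm_unitary[OF U mult_mat_vec_carrier[OF mat_diag_dim w]])
  also have "\<dots> \<le> r * l2_norm w"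
  proof -
    have Dw: "(?D *\<^sub>v w) $ i = f i * w $ i" if "i < d" for i
    proof -
      have "(?D *\<^sub>v w) $ i = (\<Sum>j<d. (if i = j then complex_of_real (f j) else 0) * w $ j)"
        using that w by (auto simp: scalar_prod_def atLeast0LessThan mat_diag_def intro!: sum.cong)
      also have "\<dots> = (\<Sum>j<d. if i = j then f j * w $ j else 0)"
        by (intro sum.cong) auto
      finally show ?thesis using that by simp
    qed
    have "dim_vec (?D *\<^sub>v w) = d" by (simp add: mat_diag_def)
    then have "l2_norm (?D *\<^sub>v w) = L2_set (\<lambda>i. \<bar>f i\<bar> * cmod (w $ i)) {..<d}"
      unfolding l2_norm_eq_L2_set by (auto simp: Dw norm_mult simp del: index_mult_mat_vec intro!: L2_set_cong)
    also have "\<dots> \<le> L2_set (\<lambda>i. r * cmod (w $ i)) {..<d}"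
      using f by (intro L2_set_mono mult_right_mono) auto
    also have "\<dots> = r * l2_norm w"
      using w r by (auto simp: l2_norm_eq_L2_set L2_set_right_distrib)
    finally show ?thesis .
  qed
  also have "l2_norm w = l2_norm v"
    unfolding w_def using unitary_mat_adjoint[OF U] v by (rule l2_norm_unitary)
  finally show "l2_norm (unitary_diag d U f *\<^sub>v v) \<le> r * l2_norm v" .
qed

subsection \<open>Commutators with logarithms\<close>

lemma tendsto_commutator_unitary_diag:
  assumes U: "unitary_mat d U" and s: "s \<in> carrier_mat d d" and ij: "i < d" "j < d"
    and f: "\<And>k. k < d \<Longrightarrow> (\<lambda>n. f n k) \<longlonglongrightarrow> g k"
  shows "(\<lambda>n. commutator s (unitary_diag d U (f n)) $$ (i, j))
    \<longlonglongrightarrow> commutator s (unitary_diag d U g) $$ (i, j)"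
proof -
  have eq: "commutator s x $$ (i, j) =
      (\<Sum>k<d. s $$ (i, k) * x $$ (k, j)) - (\<Sum>k<d. x $$ (i, k) * s $$ (k, j))"
    if "x \<in> carrier_mat d d" for x
    using that s ij by (simp add: commutator_def scalar_prod_def atLeast0LessThan)
  show ?thesis
    unfolding eq[OF unitary_diag_carrier[OF U]]
    by (intro tendsto_intros unitary_diag_tendsto[OF U] f ij) auto
qed

text \<open>Write \<open>\<rho> = exp x\<close> as the limit of \<open>(1 + x/n)\<^sup>n\<close>; since \<open>x \<le> 0\<close>, the base is a contraction
  for large \<open>n\<close>.\<close>

lemma op_bound_commutator_exp:
  assumes U: "unitary_mat d U" and s: "s \<in> carrier_mat d d"
    and x: "\<And>i. i < d \<Longrightarrow> x i \<le> 0"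
    and K: "op_bound d (commutator s (unitary_diag d U x)) K" "0 \<le> K"
  shows "op_bound d (commutator s (unitary_diag d U (\<lambda>i. exp (x i)))) K"
proof (rule op_bound_limit)
  let ?B = "\<lambda>n. unitary_diag d U (\<lambda>i. 1 + x i / real n)"
  let ?X = "\<lambda>n. commutator s (?B n ^\<^sub>m n)"
  show "?X n \<in> carrier_mat d d" for n using U s by simp
  show "commutator s (unitary_diag d U (\<lambda>i. exp (x i))) \<in> carrier_mat d d" using U s by simp
  show "(\<lambda>n. ?X n $$ (i, j)) \<longlonglongrightarrow> commutator s (unitary_diag d U (\<lambda>i. exp (x i))) $$ (i, j)"
    if "i < d" "j < d" for i j
    unfolding unitary_diag_pow[OF U] using U s that
    by (intro tendsto_commutator_unitary_diag tendsto_exp_limit_sequentially)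
  show "eventually (\<lambda>n. op_bound d (?X n) K) sequentially"
  proof -
    \<comment> \<open>For n > N the numbers \<open>1 + x i / real n\<close> lie in (0, 1], since
      \<open>x i\<close> lies between -N and 0.\<close>
    obtain N where N: "\<And>i. i < d \<Longrightarrow> \<bar>x i\<bar> \<le> real N"
    proof -
      have "\<exists>N. \<forall>i<d. \<bar>x i\<bar> \<le> real N"
      proof (intro exI allI impI)
        fix i assume "i < d"
        then have "\<bar>x i\<bar> \<le> (\<Sum>i<d. \<bar>x i\<bar>)" by (intro member_le_sum) auto
        then show "\<bar>x i\<bar> \<le> real (nat \<lceil>\<Sum>i<d. \<bar>x i\<bar>\<rceil>)" by linarith
      qed
      then show ?thesis using that by blast
    qed
    have "op_bound d (?X n) K" if n: "n \<ge> Suc N" for n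
    proof -
      have n0: "0 < real n" using n by simp
      have "\<bar>1 + x i / real n\<bar> \<le> 1" if "i < d" for i
        using N[OF that] x[OF that] n n0 by (auto simp: abs_le_iff field_simps)
      then have B1: "op_bound d (?B n) 1" by (intro op_bound_unitary_diag[OF U]) auto
      have "?B n = complex_of_real 1 \<cdot>\<^sub>m 1\<^sub>m d + complex_of_real (1 / real n) \<cdot>\<^sub>m unitary_diag d U x"
        using U by (simp add: unitary_diag_const[symmetric] unitary_diag_smult unitary_diag_add
            del: of_real_1 of_real_divide)
      then have "commutator s (?B n) =
          complex_of_real (1 / real n) \<cdot>\<^sub>m commutator s (unitary_diag d U x)"
        using U s by (simp add: commutator_add[of _ d] commutator_smult[of _ d] commutator_one[of _ d] del: of_real_divide)
      then have "op_bound d (commutator s (?B n)) (K / real n)"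
        using op_bound_smult[OF _ K(1), of "complex_of_real (1 / real n)"] U s by (simp add: norm_divide)
      \<comment> \<open>The power costs a factor \<open>n\<close> and its base has commutator bound
        \<open>K / real n\<close>, so exactly \<open>K\<close> remains.\<close>
      from op_bound_commutator_pow[OF s _ B1 _ this, of n]
      show ?thesis using U K n0 by simp
    qed
    then show ?thesis by (auto simp: eventually_sequentially)
  qed
qed

text \<open>Expand \<open>log \<sigma> = - (\<Sum>k\<ge>1. (1 - \<sigma>)\<^sup>k / k)\<close>; commuting with the \<open>k\<close>-th power costs a factor
  \<open>k (1 - l)\<^sup>k\<^sup>-\<^sup>1\<close>, and the bounds form a geometric series with sum \<open>1 / l\<close>.\<close>

lemma op_bound_commutator_ln:
  assumes U: "unitary_mat d U" and s: "s \<in> carrier_mat d d"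
    and l: "0 < l" "l \<le> 1" and \<mu>: "\<And>i. i < d \<Longrightarrow> l \<le> \<mu> i" "\<And>i. i < d \<Longrightarrow> \<mu> i \<le> 1"
    and K: "op_bound d (commutator s (unitary_diag d U \<mu>)) K" "0 \<le> K"
  shows "op_bound d (commutator s (unitary_diag d U (\<lambda>i. ln (\<mu> i)))) (K / l)"
proof (rule op_bound_limit)
  let ?B = "unitary_diag d U (\<lambda>i. 1 - \<mu> i)"
  \<comment> \<open>Partial sums of the logarithm series at \<open>\<mu> i\<close>; the index is
    shifted so that the first summand is the linear one.\<close>
  define p where "p n i = (\<Sum>k<n. - (1 / real (Suc k)) * (1 - \<mu> i) ^ Suc k)" for n i
  let ?X = "\<lambda>n. commutator s (unitary_diag d U (p n))"
  show "?X n \<in> carrier_mat d d" for n using U s by simp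
  show "commutator s (unitary_diag d U (\<lambda>i. ln (\<mu> i))) \<in> carrier_mat d d" using U s by simp
  show "(\<lambda>n. ?X n $$ (i, j)) \<longlonglongrightarrow> commutator s (unitary_diag d U (\<lambda>i. ln (\<mu> i))) $$ (i, j)"
    if "i < d" "j < d" for i j
    using U s that
  proof (rule tendsto_commutator_unitary_diag)
    fix k assume k: "k < d"
    have "0 < \<mu> k" "\<mu> k < 2" using \<mu>[OF k] l by auto
    from ln_series[OF this]
    moreover have "(-1) ^ n * (1 / real (n + 1)) * (\<mu> k - 1) ^ Suc n =
        - (1 / real (Suc n)) * (1 - \<mu> k) ^ Suc n" for n
      using power_minus[of "1 - \<mu> k" "Suc n"] by simp
    ultimately have "ln (\<mu> k) = (\<Sum>n. - (1 / real (Suc n)) * (1 - \<mu> k) ^ Suc n)" by simp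
    \<comment> \<open>\<open>ln_series\<close> identifies only the value of the infinite sum;
      convergence of the partial sums is obtained by comparison with the geometric series.\<close>
    moreover have "summable (\<lambda>n. - (1 / real (Suc n)) * (1 - \<mu> k) ^ Suc n)"
    proof (rule summable_comparison_test')
      show "summable (\<lambda>n. (1 - \<mu> k) ^ Suc n)"
        using \<mu>[OF k] l by (subst summable_Suc_iff) (auto intro!: summable_geometric)
      show "norm (- (1 / real (Suc n)) * (1 - \<mu> k) ^ Suc n) \<le> (1 - \<mu> k) ^ Suc n" for n
        using \<mu>[OF k] mult_left_mono[of 1 "real (Suc n)" "(1 - \<mu> k) ^ Suc n"]
        by (simp add: abs_mult power_abs divide_simps)
    qed
    ultimately show "(\<lambda>n. p n k) \<longlonglongrightarrow> ln (\<mu> k)"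
      unfolding p_def using summable_LIMSEQ by metis
  qed
  have B1: "op_bound d ?B (1 - l)"
    using \<mu> l by (intro op_bound_unitary_diag[OF U]) (auto simp: abs_le_iff)
  have "?B = complex_of_real 1 \<cdot>\<^sub>m 1\<^sub>m d + complex_of_real (- 1) \<cdot>\<^sub>m unitary_diag d U \<mu>"
    using U by (simp add: unitary_diag_const[symmetric] unitary_diag_smult unitary_diag_add
        del: of_real_1 of_real_minus)
  then have "commutator s ?B = complex_of_real (- 1) \<cdot>\<^sub>m commutator s (unitary_diag d U \<mu>)"
    using U s by (simp add: commutator_add[of _ d] commutator_smult[of _ d] commutator_one[of _ d] del: of_real_minus)
  then have sB: "op_bound d (commutator s ?B) K"
    using op_bound_smult[OF _ K(1), of "complex_of_real (- 1)"] U s by simp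
  have "op_bound d (?X n) (K * (\<Sum>k<n. (1 - l) ^ k))" for n
  proof (induction n)
    case 0
    have "unitary_diag d U (p 0) = complex_of_real 0 \<cdot>\<^sub>m 1\<^sub>m d"
      unfolding p_def lessThan_0 sum.empty by (rule unitary_diag_const[OF U])
    then show ?case using s
      by (auto simp: commutator_smult[of _ d] commutator_one[of _ d] op_bound_def zero_mult_mat_vec)
  next
    case (Suc n)
    let ?c = "- (1 / real (Suc n))"
    have "unitary_diag d U (p (Suc n)) =
        unitary_diag d U (p n) + complex_of_real ?c \<cdot>\<^sub>m (?B ^\<^sub>m Suc n)"
      unfolding unitary_diag_pow[OF U] unitary_diag_smult[OF U] unitary_diag_add[OF U]
      by (rule arg_cong[of _ _ "unitary_diag d U"]) (simp add: p_def fun_eq_iff)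
    then have eq: "?X (Suc n) = ?X n + complex_of_real ?c \<cdot>\<^sub>m commutator s (?B ^\<^sub>m Suc n)"
      using U s by (simp add: commutator_add[of _ d] commutator_smult[of _ d]
          del: pow_mat.simps of_real_minus of_real_divide)
    have "op_bound d (commutator s (?B ^\<^sub>m Suc n)) (real (Suc n) * (1 - l) ^ (Suc n - 1) * K)"
      using U s B1 sB K l by (intro op_bound_commutator_pow) auto
    from op_bound_smult[OF _ this, of "complex_of_real ?c"]
    have "op_bound d (complex_of_real ?c \<cdot>\<^sub>m commutator s (?B ^\<^sub>m Suc n))
        (cmod (complex_of_real ?c) * (real (Suc n) * (1 - l) ^ (Suc n - 1) * K))"
      using U s by (simp del: pow_mat.simps)
    \<comment> \<open>The series coefficient \<open>1 / real (Suc n)\<close> cancels the factor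
      \<open>real (Suc n)\<close> from differentiating the power.\<close>
    moreover have "cmod (complex_of_real ?c) * (real (Suc n) * (1 - l) ^ (Suc n - 1) * K) = K * (1 - l) ^ n"
      unfolding norm_of_real by (simp add: field_simps)
    ultimately have "op_bound d (complex_of_real ?c \<cdot>\<^sub>m commutator s (?B ^\<^sub>m Suc n)) (K * (1 - l) ^ n)"
      by (simp only:)
    then show ?case
      unfolding eq sum.lessThan_Suc distrib_left using Suc U s
      by (intro op_bound_add) (auto simp del: pow_mat.simps of_real_minus of_real_divide)
  qed
  moreover have "K * (\<Sum>k<n. (1 - l) ^ k) \<le> K / l" for n
  proof -
    have "l * (\<Sum>k<n. (1 - l) ^ k) = 1 - (1 - l) ^ n"
      using one_diff_power_eq[of "1 - l" n] by simp
    also have "\<dots> \<le> 1" using l by simp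
    finally have "(\<Sum>k<n. (1 - l) ^ k) \<le> 1 / l" using l by (simp add: field_simps)
    then show ?thesis using K(2) mult_left_mono by fastforce
  qed
  ultimately show "eventually (\<lambda>n. op_bound d (?X n) (K / l)) sequentially"
    by (intro always_eventually allI) (rule op_bound_mono)
qed

subsection \<open>Eigenvalues of density matrices\<close>

text \<open>The eigenvectors are the columns of \<open>U\<close>, which are nonzero because
  \<open>mat_adjoint U * U\<close> has ones on its diagonal.\<close>

lemma eigenvalue_unitary_diag:
  assumes U: "unitary_mat d U" and i: "i < d"
  shows "eigenvalue (unitary_diag d U \<mu>) (complex_of_real (\<mu> i))"
proof -
  note c = unitary_matD[OF U]
  let ?A = "unitary_diag d U \<mu>" and ?D = "mat_diag d (\<lambda>i. complex_of_real (\<mu> i))"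
  have "?A * U = U * ?D"
    unfolding unitary_diag_def using c
    by (simp add: assoc_mult_mat[of _ d d _ d _ d] mult_carrier_mat[of _ d d _ d]
        right_mult_one_mat[of _ d d])
  then have "col (?A * U) i = complex_of_real (\<mu> i) \<cdot>\<^sub>v col U i"
    using c(1) i by (auto simp: mat_diag_mult_right[of _ d d] mult.commute intro!: eq_vecI)
  then have "?A *\<^sub>v col U i = complex_of_real (\<mu> i) \<cdot>\<^sub>v col U i"
    using col_mult2[OF unitary_diag_carrier[OF U] c(1) i] by simp
  moreover have "col U i \<noteq> 0\<^sub>v d"
  proof
    assume "col U i = 0\<^sub>v d"
    then have "(mat_adjoint U * U) $$ (i, i) = 0" using c(1,2) i by simp
    then show False using c(3) i by simp
  qed
  ultimately show ?thesis
    using c(1) U i unfolding eigenvalue_def eigenvector_def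
    by (intro exI[of _ "col U i"]) (auto intro: carrier_vecI)
qed

lemma psd_eigenvalue_nonneg:
  assumes A: "psd_mat d A" and ev: "eigenvalue A (complex_of_real x)"
  shows "0 \<le> x"
proof -
  have Ac: "A \<in> carrier_mat d d" using A by (simp add: psd_mat_def hermitian_mat_def)
  then obtain v where v: "v \<in> carrier_vec d" "v \<noteq> 0\<^sub>v d" and Av: "A *\<^sub>v v = complex_of_real x \<cdot>\<^sub>v v"
    using ev unfolding eigenvalue_def eigenvector_def by auto
  have "0 \<le> (A *\<^sub>v v) \<bullet>c v" using A v by (simp add: psd_mat_def)
  also have "\<dots> = complex_of_real x * (v \<bullet>c v)" using v by (simp add: Av)
  finally have 1: "0 \<le> complex_of_real x * (v \<bullet>c v)" .
  have "0 < v \<bullet>c v" using v by (simp add: conjugate_square_greater_0_vec)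
  with 1 show ?thesis by (auto simp: less_eq_complex_def less_complex_def zero_le_mult_iff)
qed

text \<open>Finiteness makes the \<open>Min\<close> in \<open>min_eigenvalue\<close> an actual
  minimum; the eigenvalues are roots of a nonzero polynomial.\<close>

lemma finite_real_eigenvalues:
  assumes A: "A \<in> carrier_mat d d"
  shows "finite {x :: real. eigenvalue A (complex_of_real x)}"
proof -
  have "char_poly A \<noteq> 0" using degree_monic_char_poly[OF A] by auto
  then have "finite {z. eigenvalue A z}"
    using poly_roots_finite eigenvalue_root_char_poly[OF A] by simp
  then have "finite (complex_of_real -` {z. eigenvalue A z})"
    by (rule finite_vimageI) (simp add: inj_on_def)
  then show ?thesis by (simp add: vimage_def)
qed

lemma tr_unitary_diag:
  assumes U: "unitary_mat d U"
  shows "tr (unitary_diag d U \<mu>) = complex_of_real (\<Sum>i<d. \<mu> i)"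
proof -
  note c = unitary_matD[OF U]
  have col: "(\<Sum>i<d. cnj (U $$ (i, k)) * U $$ (i, k)) = 1" if "k < d" for k
    using arg_cong[OF c(3), of "\<lambda>M. M $$ (k, k)"] that c(1)
    by (simp add: scalar_prod_def atLeast0LessThan)
  have "tr (unitary_diag d U \<mu>) =
      (\<Sum>i<d. \<Sum>k<d. U $$ (i, k) * complex_of_real (\<mu> k) * cnj (U $$ (i, k)))"
    using U by (simp add: tr_def unitary_diag_index)
  also have "\<dots> = (\<Sum>k<d. \<Sum>i<d. U $$ (i, k) * complex_of_real (\<mu> k) * cnj (U $$ (i, k)))"
    by (rule sum.swap)
  also have "\<dots> = (\<Sum>k<d. complex_of_real (\<mu> k) * (\<Sum>i<d. cnj (U $$ (i, k)) * U $$ (i, k)))"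
    by (simp add: sum_distrib_left ac_simps)
  finally show ?thesis by (simp add: col)
qed

text \<open>Positivity combines semidefiniteness with full rank, which excludes the eigenvalue 0;
  the upper bound holds because nonnegative eigenvalues sum to the trace 1.\<close>

lemma density_unitary_diag:
  assumes \<rho>: "density_mat d \<rho>" and fr: "full_rank d \<rho>"
  obtains U \<mu> where "unitary_mat d U" "\<rho> = unitary_diag d U \<mu>"
    "\<And>i. i < d \<Longrightarrow> 0 < \<mu> i" "\<And>i. i < d \<Longrightarrow> \<mu> i \<le> 1"
    "\<And>i. i < d \<Longrightarrow> min_eigenvalue \<rho> \<le> \<mu> i"
proof -
  have psd: "psd_mat d \<rho>" and h: "hermitian_mat d \<rho>" and \<rho>c: "\<rho> \<in> carrier_mat d d"
    using \<rho> by (auto simp: density_mat_def psd_mat_def hermitian_mat_def)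
  obtain U \<mu> where U: "unitary_mat d U" and eq: "\<rho> = unitary_diag d U \<mu>"
    using hermitian_unitary_diag[OF h] by blast
  have ev: "eigenvalue \<rho> (complex_of_real (\<mu> i))" if "i < d" for i
    using eigenvalue_unitary_diag[OF U that] eq by simp
  have nn: "0 \<le> \<mu> i" if "i < d" for i
    using psd_eigenvalue_nonneg[OF psd ev[OF that]] .
  have "det \<rho> \<noteq> 0"
    using vec_space.det_rank_iff[OF \<rho>c] fr by (simp add: full_rank_def)
  then have no0: "\<not> eigenvalue \<rho> 0"
    using det_0_iff_vec_prod_zero_field[OF \<rho>c] \<rho>c unfolding eigenvalue_def eigenvector_def
    by fastforce
  have pos: "0 < \<mu> i" if "i < d" for i
    using nn[OF that] ev[OF that] no0 by (cases "\<mu> i = 0") auto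
  have "complex_of_real (\<Sum>i<d. \<mu> i) = 1"
    using \<rho> tr_unitary_diag[OF U, of \<mu>] eq by (simp add: density_mat_def)
  then have "(\<Sum>i<d. \<mu> i) = 1" using of_real_eq_1_iff by blast
  then have le1: "\<mu> i \<le> 1" if "i < d" for i
    using member_le_sum[of i "{..<d}" \<mu>] nn that by simp
  have "min_eigenvalue \<rho> \<le> \<mu> i" if "i < d" for i
    unfolding min_eigenvalue_def using finite_real_eigenvalues[OF \<rho>c] ev[OF that] by simp
  with U eq pos le1 show ?thesis using that by blast
qed

text \<open>Needed to bound the values under the infimum in \<open>lambda_min\<close> from below.
  The assumption \<open>0 < d\<close> makes the spectrum nonempty, so that \<open>Min\<close> is
  attained.\<close>

lemma min_eigenvalue_nonneg:
  assumes \<rho>: "density_mat d \<rho>" and "full_rank d \<rho>" and d: "0 < d"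
  shows "0 \<le> min_eigenvalue \<rho>"
proof -
  have psd: "psd_mat d \<rho>" and \<rho>c: "\<rho> \<in> carrier_mat d d"
    using \<rho> by (auto simp: density_mat_def psd_mat_def hermitian_mat_def)
  let ?S = "{x :: real. eigenvalue \<rho> (complex_of_real x)}"
  obtain U \<mu> where "unitary_mat d U" "\<rho> = unitary_diag d U \<mu>"
    using density_unitary_diag[OF assms(1,2)] .
  then have "\<mu> 0 \<in> ?S" using eigenvalue_unitary_diag[of d U 0 \<mu>] d by simp
  then have "Min ?S \<in> ?S" using finite_real_eigenvalues[OF \<rho>c] by (intro Min_in) auto
  then show ?thesis unfolding min_eigenvalue_def using psd_eigenvalue_nonneg[OF psd] by blast
qed

lemma lambda_min_le:
  assumes sp: "strictly_positive d \<Phi>" and \<rho>: "density_mat d \<rho>" and d: "0 < d"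
  shows "lambda_min d \<Phi> \<le> min_eigenvalue (\<Phi> \<rho>)"
  unfolding lambda_min_def
proof (rule cINF_lower)
  show "bdd_below ((\<lambda>\<rho>. min_eigenvalue (\<Phi> \<rho>)) ` {\<rho>. density_mat d \<rho>})"
    using sp min_eigenvalue_nonneg[OF _ _ d] unfolding strictly_positive_def
    by (intro bdd_belowI2[of _ 0]) auto
qed (use \<rho> in simp)

text \<open>Uniqueness of the logarithm allows the definite description to be evaluated in whichever
  diagonalisation is at hand.\<close>

lemma mat_log_unitary_diag:
  assumes U: "unitary_mat d U" and \<mu>: "\<And>i. i < d \<Longrightarrow> 0 < \<mu> i"
  shows "mat_log d (unitary_diag d U \<mu>) = unitary_diag d U (\<lambda>i. ln (\<mu> i))"
proof -
  have "log_via_diag d (unitary_diag d U \<mu>) (unitary_diag d U (\<lambda>i. ln (\<mu> i)))"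
    unfolding log_via_diag_def unitary_diag_def using assms by blast
  then show ?thesis unfolding mat_log_def using log_via_diag_unique by (intro the_equality)
qed

lemma mat_log_maximally_mixed:
  assumes "0 < d"
  shows "mat_log d (maximally_mixed d) = complex_of_real (ln (1 / real d)) \<cdot>\<^sub>m 1\<^sub>m d"
proof -
  have U: "unitary_mat d (1\<^sub>m d)" by (intro unitary_matI eq_matI) auto
  have "maximally_mixed d = unitary_diag d (1\<^sub>m d) (\<lambda>i. 1 / real d)"
    unfolding unitary_diag_const[OF U] by (simp add: maximally_mixed_def)
  then show ?thesis
    using mat_log_unitary_diag[OF U, of "\<lambda>i. 1 / real d"] assms
    unfolding unitary_diag_const[OF U] by simp
qed

subsection \<open>The commutator seminorm\<close>

text \<open>The form that \<open>L\<close> takes for a generating set \<open>S\<close>. Since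
  \<open>L\<close> is specified only on \<open>carrier_mat d d\<close>, every later use of this form
  comes with a carrier condition.\<close>

definition commutator_seminorm :: "nat \<Rightarrow> complex mat set \<Rightarrow> complex mat \<Rightarrow> ennreal" where
  "commutator_seminorm d S x = (SUP s \<in> S. ennreal (op_norm d (commutator s x)))"

lemma commutator_seminorm_finite: "finite S \<Longrightarrow> commutator_seminorm d S x < \<infinity>"
proof -
  assume S: "finite S"
  have "commutator_seminorm d S x \<le> (\<Sum>s\<in>S. ennreal (op_norm d (commutator s x)))"
    unfolding commutator_seminorm_def using S by (intro SUP_least member_le_sum) auto
  also have "\<dots> < \<infinity>" using S by (simp add: sum_ennreal less_top[symmetric])
  finally show ?thesis .
qed

lemma commutator_seminorm_smult:
  assumes S: "S \<subseteq> carrier_mat d d" and x: "x \<in> carrier_mat d d"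
  shows "commutator_seminorm d S (c \<cdot>\<^sub>m x) = ennreal (cmod c) * commutator_seminorm d S x"
proof -
  have "op_norm d (commutator s (c \<cdot>\<^sub>m x)) = cmod c * op_norm d (commutator s x)" if "s \<in> S" for s
    using that S x commutator_smult[of s d x c] op_norm_smult[of "commutator s x" d c] by auto
  then have "commutator_seminorm d S (c \<cdot>\<^sub>m x) = (SUP s \<in> S. ennreal (cmod c) * ennreal (op_norm d (commutator s x)))"
    unfolding commutator_seminorm_def by (intro SUP_cong refl) (simp add: ennreal_mult')
  then show ?thesis by (simp add: SUP_mult_left_ennreal commutator_seminorm_def)
qed

text \<open>Scalar matrices commute with every \<open>s\<close>; this removes the logarithm of the
  maximally mixed state from numerator and denominator.\<close>

lemma commutator_seminorm_shift:
  assumes S: "S \<subseteq> carrier_mat d d" and x: "x \<in> carrier_mat d d"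
  shows "commutator_seminorm d S (x - c \<cdot>\<^sub>m 1\<^sub>m d) = commutator_seminorm d S x"
proof -
  have eq: "x - c \<cdot>\<^sub>m 1\<^sub>m d = x + (- c) \<cdot>\<^sub>m 1\<^sub>m d" using x by (intro eq_matI) auto
  have "commutator s (x - c \<cdot>\<^sub>m 1\<^sub>m d) = commutator s x" if "s \<in> S" for s
  proof -
    have s: "s \<in> carrier_mat d d" using that S by auto
    then show ?thesis
      using x by (auto simp: eq commutator_add[of _ d] commutator_smult[of _ d] commutator_one[of _ d] intro!: eq_matI)
  qed
  then show ?thesis unfolding commutator_seminorm_def by simp
qed

text \<open>Write \<mu> as exp (ln \<mu>), where ln \<mu> \<le> 0 because \<mu> \<le> 1, and take
  for \<open>K\<close> the operator norm of the commutator with the logarithm.\<close>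

lemma commutator_seminorm_le_log:
  assumes S: "S \<subseteq> carrier_mat d d" and U: "unitary_mat d U"
    and \<mu>: "\<And>i. i < d \<Longrightarrow> 0 < \<mu> i" "\<And>i. i < d \<Longrightarrow> \<mu> i \<le> 1"
  shows "commutator_seminorm d S (unitary_diag d U \<mu>)
    \<le> commutator_seminorm d S (unitary_diag d U (\<lambda>i. ln (\<mu> i)))"
  unfolding commutator_seminorm_def
proof (intro SUP_mono bexI ennreal_leI)
  fix s assume "s \<in> S"
  then have s: "s \<in> carrier_mat d d" using S by auto
  let ?l = "unitary_diag d U (\<lambda>i. ln (\<mu> i))"
  have c: "commutator s ?l \<in> carrier_mat d d" using s U by simp
  have "unitary_diag d U \<mu> = unitary_diag d U (\<lambda>i. exp (ln (\<mu> i)))"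
    using \<mu> by (intro unitary_diag_cong[OF U]) simp
  then have "op_bound d (commutator s (unitary_diag d U \<mu>)) (op_norm d (commutator s ?l))"
    using op_bound_commutator_exp[OF U s _ op_bound_op_norm[OF c] op_norm_nonneg[OF c]] \<mu> by simp
  then show "op_norm d (commutator s (unitary_diag d U \<mu>)) \<le> op_norm d (commutator s ?l)"
    using op_norm_nonneg[OF c] by (rule op_norm_le)
qed

lemma commutator_seminorm_log_le:
  assumes S: "S \<subseteq> carrier_mat d d" and U: "unitary_mat d U" and d: "0 < d" and l: "0 < l"
    and \<mu>: "\<And>i. i < d \<Longrightarrow> l \<le> \<mu> i" "\<And>i. i < d \<Longrightarrow> \<mu> i \<le> 1"
  shows "commutator_seminorm d S (unitary_diag d U (\<lambda>i. ln (\<mu> i)))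
    \<le> commutator_seminorm d S (unitary_diag d U \<mu>) / ennreal l"
proof -
  \<comment> \<open>Since \<open>0 < d\<close> there is at least one eigenvalue to squeeze
    \<open>l\<close> below 1.\<close>
  have l1: "l \<le> 1" using \<mu>[OF d] by simp
  have "ennreal (op_norm d (commutator s (unitary_diag d U (\<lambda>i. ln (\<mu> i)))))
      \<le> commutator_seminorm d S (unitary_diag d U \<mu>) / ennreal l" if "s \<in> S" for s
  proof -
    have s: "s \<in> carrier_mat d d" using S that by auto
    let ?c = "commutator s (unitary_diag d U \<mu>)"
    have c: "?c \<in> carrier_mat d d" using s U by simp
    have "op_norm d (commutator s (unitary_diag d U (\<lambda>i. ln (\<mu> i)))) \<le> op_norm d ?c / l"
      using op_bound_commutator_ln[OF U s l l1 \<mu> op_bound_op_norm[OF c] op_norm_nonneg[OF c]]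
        op_norm_nonneg[OF c] l by (intro op_norm_le) auto
    then have "ennreal (op_norm d (commutator s (unitary_diag d U (\<lambda>i. ln (\<mu> i))))) \<le> ennreal (op_norm d ?c) / ennreal l"
      using op_norm_nonneg[OF c] l by (simp add: divide_ennreal ennreal_leI)
    also have "\<dots> \<le> commutator_seminorm d S (unitary_diag d U \<mu>) / ennreal l"
      unfolding commutator_seminorm_def using that
      by (intro divide_right_mono_ennreal SUP_upper2[of s]) auto
    finally show ?thesis .
  qed
  then show ?thesis unfolding commutator_seminorm_def by (intro SUP_least)
qed

text \<open>Homogeneity: rescale \<open>x\<close> into the unit ball of the seminorm. If
  \<open>L x = 0\<close>, all multiples are admissible, which forces \<open>L (\<Phi> x) = 0\<close>
  when the Lipschitz constant is finite. For an infinite constant this could fail, as \<infinity>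
  times 0 is 0 in \<open>ennreal\<close>.\<close>

lemma Lip_bound:
  assumes S: "finite S" "S \<subseteq> carrier_mat d d"
    and L: "\<And>x. x \<in> carrier_mat d d \<Longrightarrow> L x = commutator_seminorm d S x"
    and \<Phi>: "linear_map_mat d \<Phi>" and x: "hermitian_mat d x" and fin: "Lip d L \<Phi> < \<infinity>"
  shows "L (\<Phi> x) \<le> Lip d L \<Phi> * L x"
proof -
  have xc: "x \<in> carrier_mat d d" using x by (simp add: hermitian_mat_def)
  have \<Phi>x: "\<Phi> x \<in> carrier_mat d d" using \<Phi> xc by (simp add: linear_map_mat_def)
  have Lc: "L (complex_of_real t \<cdot>\<^sub>m y) = ennreal t * L y" if "y \<in> carrier_mat d d" "0 \<le> t" for t y
    using commutator_seminorm_smult[OF S(2) that(1), of "complex_of_real t"] that by (simp add: L)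
  have test: "ennreal t * L (\<Phi> x) \<le> Lip d L \<Phi>" if t: "0 \<le> t" "ennreal t * L x \<le> 1" for t
  proof -
    have "hermitian_mat d (complex_of_real t \<cdot>\<^sub>m x)"
    proof -
      have "cnj (x $$ (j, i)) = x $$ (i, j)" if "i < d" "j < d" for i j
        using x that unfolding hermitian_mat_def by (metis carrier_matD mat_adjoint_index)
      then show ?thesis using xc by (auto simp: hermitian_mat_def intro!: eq_matI)
    qed
    then have "L (\<Phi> (complex_of_real t \<cdot>\<^sub>m x)) \<le> Lip d L \<Phi>"
      unfolding Lip_def using t xc by (intro SUP_upper) (simp add: Lc)
    then show ?thesis using \<Phi> xc \<Phi>x t by (simp add: linear_map_mat_def Lc)
  qed
  obtain a where a: "L x = ennreal a" "0 \<le> a"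
    using commutator_seminorm_finite[OF S(1), of d x] L[OF xc]
    by (auto simp: less_top_ennreal)
  obtain b where b: "L (\<Phi> x) = ennreal b" "0 \<le> b"
    using commutator_seminorm_finite[OF S(1), of d "\<Phi> x"] L[OF \<Phi>x]
    by (auto simp: less_top_ennreal)
  obtain l where l: "Lip d L \<Phi> = ennreal l" "0 \<le> l" using fin by (cases "Lip d L \<Phi>") auto
  have test': "t * b \<le> l" if "0 \<le> t" "t * a \<le> 1" for t
    using test[OF that(1)] that a b l by (simp add: ennreal_mult[symmetric] ennreal_le_1)
  have "b \<le> l * a"
  proof (cases "a = 0")
    case True
    have "b = 0"
    proof (rule ccontr)
      assume "b \<noteq> 0"
      then show False using test'[of "(l + 1) / b"] True b l by simp
    qed
    then show ?thesis using l a by simp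
  next
    case False
    then show ?thesis using test'[of "1 / a"] a by (simp add: field_simps)
  qed
  then show ?thesis using a b l by (simp add: ennreal_mult[symmetric])
qed

text \<open>The chain is log \<Phi>(\<rho>) to \<Phi>(\<rho>), then to \<rho>, then to log \<rho>;
  the case distinctions concern only infinite or vanishing quantities.\<close>

lemma LogLip_quotient:
  assumes d: "0 < d" and S: "finite S" "S \<subseteq> carrier_mat d d"
    and L: "\<And>x. x \<in> carrier_mat d d \<Longrightarrow> L x = commutator_seminorm d S x"
    and \<Phi>: "linear_map_mat d \<Phi>" and sp: "strictly_positive d \<Phi>"
    and \<rho>: "density_mat d \<rho>" "full_rank d \<rho>"
    and nz: "\<not> (L (mat_log d (\<Phi> \<rho>)) = 0 \<and> L (mat_log d \<rho>) = 0)"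
  shows "L (mat_log d (\<Phi> \<rho>)) / L (mat_log d \<rho>) \<le> Lip d L \<Phi> * (1 / ennreal (lambda_min d \<Phi>))"
proof (cases "Lip d L \<Phi> = \<infinity>")
  case True
  have "1 / ennreal (lambda_min d \<Phi>) \<noteq> 0" by (simp add: ennreal_divide_eq_0_iff)
  then show ?thesis unfolding True by (simp add: ennreal_top_mult)
next
  case False
  let ?N = "L (mat_log d (\<Phi> \<rho>))" and ?M = "L (mat_log d \<rho>)"
  have \<sigma>: "density_mat d (\<Phi> \<rho>)" "full_rank d (\<Phi> \<rho>)" using sp \<rho> by (auto simp: strictly_positive_def)
  obtain U \<mu> where U: "unitary_mat d U" and \<rho>eq: "\<rho> = unitary_diag d U \<mu>"
    and \<mu>: "\<And>i. i < d \<Longrightarrow> 0 < \<mu> i" "\<And>i. i < d \<Longrightarrow> \<mu> i \<le> 1"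
    using density_unitary_diag[OF \<rho>] by blast
  obtain V \<nu> where V: "unitary_mat d V" and \<sigma>eq: "\<Phi> \<rho> = unitary_diag d V \<nu>"
    and \<nu>: "\<And>i. i < d \<Longrightarrow> 0 < \<nu> i" "\<And>i. i < d \<Longrightarrow> \<nu> i \<le> 1"
      "\<And>i. i < d \<Longrightarrow> min_eigenvalue (\<Phi> \<rho>) \<le> \<nu> i"
    using density_unitary_diag[OF \<sigma>] by blast
  have "L \<rho> \<le> ?M"
    using commutator_seminorm_le_log[OF S(2) U \<mu>] mat_log_unitary_diag[OF U \<mu>(1)] U
    by (simp add: L \<rho>eq)
  moreover have "L (\<Phi> \<rho>) \<le> Lip d L \<Phi> * L \<rho>"
    using \<rho> False by (intro Lip_bound[OF S L \<Phi>]) (auto simp: density_mat_def psd_mat_def less_top)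
  ultimately have Lip: "L (\<Phi> \<rho>) \<le> Lip d L \<Phi> * ?M"
    by (meson mult_left_mono order_trans zero_le)
  have bound: "?N \<le> L (\<Phi> \<rho>) / ennreal l" if "0 < l" "\<And>i. i < d \<Longrightarrow> l \<le> \<nu> i" for l
    using commutator_seminorm_log_le[OF S(2) V d that \<nu>(2)] mat_log_unitary_diag[OF V \<nu>(1)] V
    by (simp add: L \<sigma>eq)
  \<comment> \<open>The smallest eigenvalue of this particular \<open>\<Phi> \<rho>\<close> is
    positive by strict positivity, so the argument does not rely on the infimum
    \<open>lambda_min\<close>.\<close>
  have N0: "?N = 0" if "L (\<Phi> \<rho>) = 0"
  proof -
    have "Min (\<nu> ` {..<d}) \<in> \<nu> ` {..<d}" using d by (intro Min_in) auto
    then have "0 < Min (\<nu> ` {..<d})" using \<nu>(1) by auto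
    then have "?N \<le> L (\<Phi> \<rho>) / ennreal (Min (\<nu> ` {..<d}))" by (intro bound) auto
    then show ?thesis using that by simp
  qed
  \<comment> \<open>A vanishing denominator makes \<open>L (\<Phi> \<rho>)\<close> and with it the
    numerator vanish, which is the excluded quotient 0/0.\<close>
  have M: "?M \<noteq> 0" using N0 Lip nz by auto
  have "?M < \<infinity>"
    using commutator_seminorm_finite[OF S(1)] mat_log_unitary_diag[OF U \<mu>(1)] U
    by (simp add: L \<rho>eq)
  show ?thesis
  proof (cases "0 < lambda_min d \<Phi>")
    case True
    have "lambda_min d \<Phi> \<le> \<nu> i" if "i < d" for i
      using lambda_min_le[OF sp \<rho>(1) d] \<nu>(3)[OF that] by simp
    then have "?N \<le> L (\<Phi> \<rho>) / ennreal (lambda_min d \<Phi>)" using True by (intro bound)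
    also have "\<dots> \<le> Lip d L \<Phi> * ?M / ennreal (lambda_min d \<Phi>)"
      by (intro divide_right_mono_ennreal Lip)
    also have "\<dots> = ?M * (Lip d L \<Phi> * (1 / ennreal (lambda_min d \<Phi>)))"
      by (simp add: ennreal_times_divide mult.commute)
    finally show ?thesis using M \<open>?M < \<infinity>\<close>
      by (simp add: divide_le_posI_ennreal zero_less_iff_neq_zero)
  next
    case nonpos: False
    \<comment> \<open>\<open>ennreal\<close> sends nonpositive reals to 0, so the last factor of the
      bound becomes \<infinity>; only a zero Lipschitz constant keeps the right-hand side
      finite.\<close>
    then have l0: "ennreal (lambda_min d \<Phi>) = 0" by (simp add: ennreal_neg)
    show ?thesis
    proof (cases "Lip d L \<Phi> = 0")
      case True
      then have "?N = 0" using Lip N0 by simp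
      then show ?thesis by simp
    next
      case False
      then show ?thesis unfolding l0 by (simp add: ennreal_divide_zero ennreal_mult_top)
    qed
  qed
qed

theorem proposition5p9:
  shows "\<exists>c_abs :: real. c_abs > 0 \<and>
    (\<forall>(d :: nat) (L :: complex mat \<Rightarrow> ennreal) (\<Phi> :: complex mat \<Rightarrow> complex mat).
       d \<ge> 2 \<longrightarrow>
       commutator_lipschitz_seminorm d L \<longrightarrow>
       unital_map d \<Phi> \<longrightarrow>
       strictly_positive d \<Phi> \<longrightarrow>
       completely_positive d \<Phi> \<longrightarrow>
       trace_preserving d \<Phi> \<longrightarrow>
       LogLip d L \<Phi> (maximally_mixed d)
         \<le> ennreal c_abs * Lip d L \<Phi> * (ennreal ((ln (real d))\<^sup>2) / ennreal (lambda_min d \<Phi>)))"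
proof (intro exI[of _ "1 / (ln 2)\<^sup>2"] conjI allI impI)
  show "0 < 1 / (ln (2 :: real))\<^sup>2" by simp
  fix d :: nat and L :: "complex mat \<Rightarrow> ennreal" and \<Phi> :: "complex mat \<Rightarrow> complex mat"
  assume d2: "d \<ge> 2" and "commutator_lipschitz_seminorm d L"
    and sp: "strictly_positive d \<Phi>" and "completely_positive d \<Phi>"
  then obtain S where S: "finite S" "S \<subseteq> carrier_mat d d"
    and L: "\<And>x. x \<in> carrier_mat d d \<Longrightarrow> L x = commutator_seminorm d S x"
    unfolding commutator_lipschitz_seminorm_def commutator_seminorm_def commutator_def by blast
  have d: "0 < d" using d2 by simp
  have \<Phi>: "linear_map_mat d \<Phi>" using \<open>completely_positive d \<Phi>\<close> by (simp add: completely_positive_def)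
  let ?B = "ennreal (1 / (ln 2)\<^sup>2) * Lip d L \<Phi> * (ennreal ((ln (real d))\<^sup>2) / ennreal (lambda_min d \<Phi>))"
  have shift: "L (mat_log d \<rho> - mat_log d (maximally_mixed d)) = L (mat_log d \<rho>)"
    if \<rho>: "density_mat d \<rho>" "full_rank d \<rho>" for \<rho>
  proof -
    obtain U \<mu> where U: "unitary_mat d U" and "\<rho> = unitary_diag d U \<mu>"
      and "\<And>i. i < d \<Longrightarrow> 0 < \<mu> i"
      using density_unitary_diag[OF \<rho>] by blast
    \<comment> \<open>Membership in the carrier has to come from a diagonalisation, because
      \<open>mat_log\<close> is a definite description; without it \<open>L\<close> cannot be
      unfolded.\<close>
    then have c: "mat_log d \<rho> \<in> carrier_mat d d" using mat_log_unitary_diag[OF U] by simp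
    then have "mat_log d \<rho> - mat_log d (maximally_mixed d) \<in> carrier_mat d d"
      by (simp add: mat_log_maximally_mixed[OF d] minus_carrier_mat)
    then show ?thesis
      using c commutator_seminorm_shift[OF S(2) c] by (simp add: L mat_log_maximally_mixed[OF d])
  qed
  \<comment> \<open>The constant \<open>1 / (ln 2)^2\<close> is chosen so that its product with
    \<open>(ln (real d))^2\<close> is at least 1 for every \<open>d \<ge> 2\<close>.\<close>
  have "1 * (Lip d L \<Phi> * (1 / ennreal (lambda_min d \<Phi>)))
      \<le> ennreal (1 / (ln 2)\<^sup>2 * (ln (real d))\<^sup>2) * (Lip d L \<Phi> * (1 / ennreal (lambda_min d \<Phi>)))"
  proof (rule mult_right_mono)
    have "(ln 2)\<^sup>2 \<le> (ln (real d))\<^sup>2" using d2 by (intro power_mono) auto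
    then have "1 \<le> 1 / (ln 2)\<^sup>2 * (ln (real d))\<^sup>2" by simp
    then show "1 \<le> ennreal (1 / (ln 2)\<^sup>2 * (ln (real d))\<^sup>2)" by (simp only: ennreal_ge_1)
  qed simp
  also have "\<dots> = ?B"
    unfolding ennreal_mult[OF zero_le_divide_1_iff[THEN iffD2, OF zero_le_power2] zero_le_power2]
    by (simp only: divide_ennreal_def mult_1 mult_ac)
  finally have B: "Lip d L \<Phi> * (1 / ennreal (lambda_min d \<Phi>)) \<le> ?B" by simp
  show "LogLip d L \<Phi> (maximally_mixed d) \<le> ?B"
    unfolding LogLip_def Let_def
  proof (rule SUP_least)
    fix \<rho> assume "\<rho> \<in> {\<rho>. density_mat d \<rho> \<and> full_rank d \<rho> \<and>
      \<not> (L (mat_log d (\<Phi> \<rho>) - mat_log d (maximally_mixed d)) = 0 \<and>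
        L (mat_log d \<rho> - mat_log d (maximally_mixed d)) = 0)}"
    then have \<rho>: "density_mat d \<rho>" "full_rank d \<rho>"
      and nz: "\<not> (L (mat_log d (\<Phi> \<rho>) - mat_log d (maximally_mixed d)) = 0 \<and>
        L (mat_log d \<rho> - mat_log d (maximally_mixed d)) = 0)" by auto
    have "density_mat d (\<Phi> \<rho>)" "full_rank d (\<Phi> \<rho>)" using sp \<rho> by (auto simp: strictly_positive_def)
    note eq = shift[OF \<rho>] shift[OF this]
    show "L (mat_log d (\<Phi> \<rho>) - mat_log d (maximally_mixed d)) /
        L (mat_log d \<rho> - mat_log d (maximally_mixed d)) \<le> ?B"
      using LogLip_quotient[OF d S L \<Phi> sp \<rho>] nz B unfolding eq by (meson order_trans)
  qed
qed

end
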